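(* Let $M_1$, $M_2$ be preGarside monoids, and let $N$ be a common parabolic submonoid. Set $M = M_1*_NM_2$. (1) If $M'_1$ and $M'_2$ are parabolic submonoids of $M_1$ and $M_2$, respectively, such that $M'_1\cap N = M'_2\cap N$, then $M'_1*_{N'}M'_2$ is (canonically isomorphic to) a parabolic submonoid of $M$, where $N' = M'_1\cap N$. In particular, $M_1$, $M_2$, and $N$ are parabolic submonoids of $M$. (2) If $M'$ is a parabolic submonoid of $M$, then there exist parabolic submonoids $M_1'$, $M_2'$, and $N'$ of $M_1$, $M_2$, and $N$, respectively, such that $M_1' \cap N = M_2' \cap N = N'$, and $M'$ is equal (isomorphic) to $M_1'*_{N'}M_2'$.
   Context: For a monoid $M$: $b\preceq_L a$ means $a=bc$ for some $c\in M$; $c\preceq_R a$ means $a=bc$ for some $b\in M$. $M$ is cancellative if $cad=cbd$ implies $a=b$. $M$ is atomic if there is a map $\nu:M\to\mathbb{N}$ with $\nu(a)>0$ for $a\ne 1$ and $\nu(ab)\ge\nu(a)+\nu(b)$. A preGarside monoid is a cancellative atomic monoid $M$ such that, for all $a,b\in M$, if $a,b$ have a common upper bound for $\preceq_L$ then they have a least one, $a\vee_L b$, and if they have a common upper bound for $\preceq_R$ then they have a least one, $a\vee_R b$. A submonoid $N$ of a preGarside monoid $M$ is (standard) parabolic if (i) $ab\in N$ implies $a,b\in N$ for all $a,b\in M$; and (ii) for all $a,b\in N$, $a\vee_L b\in N$ whenever it exists in $M$, and $a\vee_R b\in N$ whenever it exists in $M$. A parabolic submonoid is itself preGarside. "$N$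 is a common parabolic submonoid of $M_1$ and $M_2$" means that injective monoid morphisms $\iota_i:N\to M_i$ are given with $\iota_i(N)$ parabolic in $M_i$ for $i=1,2$. $M_1*_NM_2$ is the amalgamated product (pushout of $\iota_1,\iota_2$ in the category of monoids); it is a preGarside monoid, $M_1,M_2,N$ embed in it with $M_1\cap M_2=N$, and they are identified with their images. The canonical map $M_1'*_{N'}M_2'\to M_1*_NM_2$ is the one induced by the inclusions $M'_i \subseteq M_i$. *)

theory Defs
  imports "HOL-Algebra.Group"
begin

section \<open>PreGarside monoids and parabolic submonoids\<close>

definition le_L :: "('a, 'm) monoid_scheme \<Rightarrow> 'a \<Rightarrow> 'a \<Rightarrow> bool"
  where "le_L M b a \<longleftrightarrow> (\<exists>c \<in> carrier M. a = b \<otimes>\<^bsub>M\<^esub> c)"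

definition le_R :: "('a, 'm) monoid_scheme \<Rightarrow> 'a \<Rightarrow> 'a \<Rightarrow> bool"
  where "le_R M c a \<longleftrightarrow> (\<exists>b \<in> carrier M. a = b \<otimes>\<^bsub>M\<^esub> c)"

text \<open>\<open>is_join r S a b c\<close>: the element \<open>c\<close> is a least common upper bound of \<open>a\<close> and \<open>b\<close> in \<open>S\<close>.
  In a preGarside monoid both divisibility relations are partial orders (1 is the only unit),
  so such a \<open>c\<close> is unique when it exists.\<close>

definition is_join :: "('a \<Rightarrow> 'a \<Rightarrow> bool) \<Rightarrow> 'a set \<Rightarrow> 'a \<Rightarrow> 'a \<Rightarrow> 'a \<Rightarrow> bool"
  where "is_join r S a b c \<longleftrightarrow>
    c \<in> S \<and> r a c \<and> r b c \<and> (\<forall>d \<in> S. r a d \<and> r b d \<longrightarrow> r c d)"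

definition cancellative :: "('a, 'm) monoid_scheme \<Rightarrow> bool"
  where "cancellative M \<longleftrightarrow>
    (\<forall>a \<in> carrier M. \<forall>b \<in> carrier M. \<forall>c \<in> carrier M. \<forall>d \<in> carrier M.
       c \<otimes>\<^bsub>M\<^esub> a \<otimes>\<^bsub>M\<^esub> d = c \<otimes>\<^bsub>M\<^esub> b \<otimes>\<^bsub>M\<^esub> d \<longrightarrow> a = b)"

definition atomic :: "('a, 'm) monoid_scheme \<Rightarrow> bool"
  where "atomic M \<longleftrightarrow>
    (\<exists>\<nu> :: 'a \<Rightarrow> nat.
       (\<forall>a \<in> carrier M. a \<noteq> \<one>\<^bsub>M\<^esub> \<longrightarrow> \<nu> a > 0) \<and>
       (\<forall>a \<in> carrier M. \<forall>b \<in> carrier M. \<nu> (a \<otimes>\<^bsub>M\<^esub> b) \<ge> \<nu> a + \<nu> b))"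

definition preGarside :: "('a, 'm) monoid_scheme \<Rightarrow> bool"
  where "preGarside M \<longleftrightarrow>
    monoid M \<and> cancellative M \<and> atomic M \<and>
    (\<forall>a \<in> carrier M. \<forall>b \<in> carrier M.
       (\<exists>c \<in> carrier M. le_L M a c \<and> le_L M b c) \<longrightarrow> (\<exists>c. is_join (le_L M) (carrier M) a b c)) \<and>
    (\<forall>a \<in> carrier M. \<forall>b \<in> carrier M.
       (\<exists>c \<in> carrier M. le_R M a c \<and> le_R M b c) \<longrightarrow> (\<exists>c. is_join (le_R M) (carrier M) a b c))"

text \<open>The joins are those of the ambient monoid \<open>M\<close>, not joins computed inside \<open>N\<close>.
  The conditions only mention the monoid structure of \<open>M\<close>; that the ambient monoid is
  preGarside is not part of the predicate.\<close>

definition parabolic :: "'a set \<Rightarrow> ('a, 'm) monoid_scheme \<Rightarrow> bool"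
  where "parabolic N M \<longleftrightarrow>
    submonoid N M \<and>
    (\<forall>a \<in> carrier M. \<forall>b \<in> carrier M. a \<otimes>\<^bsub>M\<^esub> b \<in> N \<longrightarrow> a \<in> N \<and> b \<in> N) \<and>
    (\<forall>a \<in> N. \<forall>b \<in> N. \<forall>c. is_join (le_L M) (carrier M) a b c \<longrightarrow> c \<in> N) \<and>
    (\<forall>a \<in> N. \<forall>b \<in> N. \<forall>c. is_join (le_R M) (carrier M) a b c \<longrightarrow> c \<in> N)"

text \<open>The library's \<^const>\<open>hom\<close> does not require preservation of the unit.\<close>

definition monoid_hom :: "('a, 'm) monoid_scheme \<Rightarrow> ('b, 'n) monoid_scheme \<Rightarrow> ('a \<Rightarrow> 'b) set"
  where "monoid_hom M P = {h \<in> hom M P. h \<one>\<^bsub>M\<^esub> = \<one>\<^bsub>P\<^esub>}"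

definition parabolic_embedding ::
    "('a \<Rightarrow> 'b) \<Rightarrow> ('a, 'm) monoid_scheme \<Rightarrow> ('b, 'n) monoid_scheme \<Rightarrow> bool"
  where "parabolic_embedding h N M \<longleftrightarrow>
    h \<in> monoid_hom N M \<and> inj_on h (carrier N) \<and> parabolic (h ` carrier N) M"

abbreviation restrict_monoid :: "'a monoid \<Rightarrow> 'a set \<Rightarrow> 'a monoid"
  where "restrict_monoid M A \<equiv> M\<lparr>carrier := A\<rparr>"


section \<open>Amalgamated products\<close>

text \<open>The pushout of \<open>\<iota>1 : N \<rightarrow> M1\<close> and \<open>\<iota>2 : N \<rightarrow> M2\<close> in the category of monoids is realised as
  the free monoid on the disjoint union of the carriers of \<open>M1\<close> and \<open>M2\<close>, modulo the congruence
  generated by the multiplication tables of \<open>M1\<close> and \<open>M2\<close> and by \<open>\<iota>1 n = \<iota>2 n\<close>. The universal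
  property is proved below; it cannot itself serve as a definition, as it quantifies over
  monoids of arbitrary type.\<close>

definition amalg_words :: "'a monoid \<Rightarrow> 'b monoid \<Rightarrow> ('a + 'b) list set"
  where "amalg_words M1 M2 = lists (carrier M1 <+> carrier M2)"

lemma amalg_words_simps [simp]:
  "[] \<in> amalg_words M1 M2"
  "Inl x # w \<in> amalg_words M1 M2 \<longleftrightarrow> x \<in> carrier M1 \<and> w \<in> amalg_words M1 M2"
  "Inr y # w \<in> amalg_words M1 M2 \<longleftrightarrow> y \<in> carrier M2 \<and> w \<in> amalg_words M1 M2"
  "v @ w \<in> amalg_words M1 M2 \<longleftrightarrow> v \<in> amalg_words M1 M2 \<and> w \<in> amalg_words M1 M2"
  by (auto simp: amalg_words_def)

inductive amalg_eq ::
    "'a monoid \<Rightarrow> 'b monoid \<Rightarrow> 'c monoid \<Rightarrow> ('c \<Rightarrow> 'a) \<Rightarrow> ('c \<Rightarrow> 'b) \<Rightarrow>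
     ('a + 'b) list \<Rightarrow> ('a + 'b) list \<Rightarrow> bool"
  for M1 M2 N \<iota>1 \<iota>2 where
  refl: "w \<in> amalg_words M1 M2 \<Longrightarrow> amalg_eq M1 M2 N \<iota>1 \<iota>2 w w"
| sym: "amalg_eq M1 M2 N \<iota>1 \<iota>2 v w \<Longrightarrow> amalg_eq M1 M2 N \<iota>1 \<iota>2 w v"
| trans: "amalg_eq M1 M2 N \<iota>1 \<iota>2 u v \<Longrightarrow> amalg_eq M1 M2 N \<iota>1 \<iota>2 v w \<Longrightarrow>
    amalg_eq M1 M2 N \<iota>1 \<iota>2 u w"
| append: "amalg_eq M1 M2 N \<iota>1 \<iota>2 u u' \<Longrightarrow> amalg_eq M1 M2 N \<iota>1 \<iota>2 v v' \<Longrightarrow>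
    amalg_eq M1 M2 N \<iota>1 \<iota>2 (u @ v) (u' @ v')"
| one1: "amalg_eq M1 M2 N \<iota>1 \<iota>2 [Inl \<one>\<^bsub>M1\<^esub>] []"
| one2: "amalg_eq M1 M2 N \<iota>1 \<iota>2 [Inr \<one>\<^bsub>M2\<^esub>] []"
| mult1: "x \<in> carrier M1 \<Longrightarrow> y \<in> carrier M1 \<Longrightarrow>
    amalg_eq M1 M2 N \<iota>1 \<iota>2 [Inl x, Inl y] [Inl (x \<otimes>\<^bsub>M1\<^esub> y)]"
| mult2: "x \<in> carrier M2 \<Longrightarrow> y \<in> carrier M2 \<Longrightarrow>
    amalg_eq M1 M2 N \<iota>1 \<iota>2 [Inr x, Inr y] [Inr (x \<otimes>\<^bsub>M2\<^esub> y)]"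
| glue: "n \<in> carrier N \<Longrightarrow> amalg_eq M1 M2 N \<iota>1 \<iota>2 [Inl (\<iota>1 n)] [Inr (\<iota>2 n)]"

definition amalg_class ::
    "'a monoid \<Rightarrow> 'b monoid \<Rightarrow> 'c monoid \<Rightarrow> ('c \<Rightarrow> 'a) \<Rightarrow> ('c \<Rightarrow> 'b) \<Rightarrow>
     ('a + 'b) list \<Rightarrow> ('a + 'b) list set"
  where "amalg_class M1 M2 N \<iota>1 \<iota>2 w = {v. amalg_eq M1 M2 N \<iota>1 \<iota>2 w v}"

definition amalg ::
    "'a monoid \<Rightarrow> 'b monoid \<Rightarrow> 'c monoid \<Rightarrow> ('c \<Rightarrow> 'a) \<Rightarrow> ('c \<Rightarrow> 'b) \<Rightarrow>
     ('a + 'b) list set monoid"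
  where "amalg M1 M2 N \<iota>1 \<iota>2 =
    \<lparr>carrier = amalg_class M1 M2 N \<iota>1 \<iota>2 ` amalg_words M1 M2,
     mult = (\<lambda>X Y. \<Union>u \<in> X. \<Union>v \<in> Y. amalg_class M1 M2 N \<iota>1 \<iota>2 (u @ v)),
     one = amalg_class M1 M2 N \<iota>1 \<iota>2 []\<rparr>"

definition amalg_inl ::
    "'a monoid \<Rightarrow> 'b monoid \<Rightarrow> 'c monoid \<Rightarrow> ('c \<Rightarrow> 'a) \<Rightarrow> ('c \<Rightarrow> 'b) \<Rightarrow> 'a \<Rightarrow> ('a + 'b) list set"
  where "amalg_inl M1 M2 N \<iota>1 \<iota>2 x = amalg_class M1 M2 N \<iota>1 \<iota>2 [Inl x]"

definition amalg_inr ::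
    "'a monoid \<Rightarrow> 'b monoid \<Rightarrow> 'c monoid \<Rightarrow> ('c \<Rightarrow> 'a) \<Rightarrow> ('c \<Rightarrow> 'b) \<Rightarrow> 'b \<Rightarrow> ('a + 'b) list set"
  where "amalg_inr M1 M2 N \<iota>1 \<iota>2 y = amalg_class M1 M2 N \<iota>1 \<iota>2 [Inr y]"

definition word_eval ::
    "('d, 'm) monoid_scheme \<Rightarrow> ('a \<Rightarrow> 'd) \<Rightarrow> ('b \<Rightarrow> 'd) \<Rightarrow> ('a + 'b) list \<Rightarrow> 'd"
  where "word_eval P f g w = foldr (\<lambda>l p. case_sum f g l \<otimes>\<^bsub>P\<^esub> p) w \<one>\<^bsub>P\<^esub>"

text \<open>The morphism out of the amalgamated product induced by \<open>f : M1 \<rightarrow> P\<close> and \<open>g : M2 \<rightarrow> P\<close>: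
  evaluate any representing word in \<open>P\<close>.\<close>

definition amalg_lift ::
    "('d, 'm) monoid_scheme \<Rightarrow> ('a \<Rightarrow> 'd) \<Rightarrow> ('b \<Rightarrow> 'd) \<Rightarrow> ('a + 'b) list set \<Rightarrow> 'd"
  where "amalg_lift P f g X = the_elem (word_eval P f g ` X)"

text \<open>The canonical map from \<open>M1' *\<^bsub>N'\<^esub> M2'\<close> to \<open>M1 *\<^bsub>N\<^esub> M2\<close> for submonoids
  \<open>M1'\<close>, \<open>M2'\<close>, \<open>N'\<close>. Its defining expression does not depend on \<open>M1'\<close>, \<open>M2'\<close>, \<open>N'\<close>.\<close>

definition amalg_canon ::
    "'a monoid \<Rightarrow> 'b monoid \<Rightarrow> 'c monoid \<Rightarrow> ('c \<Rightarrow> 'a) \<Rightarrow> ('c \<Rightarrow> 'b) \<Rightarrow>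
     ('a + 'b) list set \<Rightarrow> ('a + 'b) list set"
  where "amalg_canon M1 M2 N \<iota>1 \<iota>2 =
    amalg_lift (amalg M1 M2 N \<iota>1 \<iota>2) (amalg_inl M1 M2 N \<iota>1 \<iota>2) (amalg_inr M1 M2 N \<iota>1 \<iota>2)"


subsection \<open>The universal property\<close>

locale amalg_data =
  fixes M1 :: "'a monoid" and M2 :: "'b monoid" and N :: "'c monoid"
    and \<iota>1 :: "'c \<Rightarrow> 'a" and \<iota>2 :: "'c \<Rightarrow> 'b"
  assumes M1: "monoid M1" and M2: "monoid M2"
    and \<iota>1: "\<iota>1 \<in> carrier N \<rightarrow> carrier M1" and \<iota>2: "\<iota>2 \<in> carrier N \<rightarrow> carrier M2"
begin

abbreviation "eqv \<equiv> amalg_eq M1 M2 N \<iota>1 \<iota>2"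
abbreviation "cls \<equiv> amalg_class M1 M2 N \<iota>1 \<iota>2"
abbreviation "A \<equiv> amalg M1 M2 N \<iota>1 \<iota>2"
abbreviation "inl \<equiv> amalg_inl M1 M2 N \<iota>1 \<iota>2"
abbreviation "inr \<equiv> amalg_inr M1 M2 N \<iota>1 \<iota>2"

lemma eqv_words: "eqv u v \<Longrightarrow> u \<in> amalg_words M1 M2 \<and> v \<in> amalg_words M1 M2"
  by (induction rule: amalg_eq.induct)
    (use M1 M2 \<iota>1 \<iota>2 in \<open>auto simp: monoid.one_closed monoid.m_closed\<close>)

lemma cls_eqI: "eqv u v \<Longrightarrow> cls u = cls v"
  unfolding amalg_class_def by (rule Collect_cong) (meson amalg_eq.sym amalg_eq.trans)

lemma cls_self: "w \<in> amalg_words M1 M2 \<Longrightarrow> w \<in> cls w"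
  unfolding amalg_class_def by (auto intro: amalg_eq.refl)

lemma mult_cls:
  assumes "u \<in> amalg_words M1 M2" "v \<in> amalg_words M1 M2"
  shows "cls u \<otimes>\<^bsub>A\<^esub> cls v = cls (u @ v)"
proof -
  have "cls (u' @ v') = cls (u @ v)" if "u' \<in> cls u" "v' \<in> cls v" for u' v'
  proof (rule cls_eqI[OF amalg_eq.append])
    show "eqv u' u" "eqv v' v" using that by (simp_all add: amalg_class_def amalg_eq.sym)
  qed
  then have "(\<Union>v' \<in> cls v. cls (u' @ v')) = cls (u @ v)" if "u' \<in> cls u" for u'
    using cls_self[OF assms(2)] that by (intro UN_constant_eq) blast+
  then have "(\<Union>u' \<in> cls u. \<Union>v' \<in> cls v. cls (u' @ v')) = cls (u @ v)"
    using cls_self[OF assms(1)] by (intro UN_constant_eq) blast+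
  then show ?thesis by (simp add: amalg_def)
qed

lemma carrier_A: "carrier A = cls ` amalg_words M1 M2"
  and one_A: "\<one>\<^bsub>A\<^esub> = cls []"
  by (simp_all add: amalg_def)

lemma monoid_A: "monoid A"
proof (rule monoidI)
  fix x y assume "x \<in> carrier A" "y \<in> carrier A"
  then show "x \<otimes>\<^bsub>A\<^esub> y \<in> carrier A"
    by (auto simp: carrier_A mult_cls)
next
  show "\<one>\<^bsub>A\<^esub> \<in> carrier A" by (simp add: carrier_A one_A)
next
  fix x y z assume "x \<in> carrier A" "y \<in> carrier A" "z \<in> carrier A"
  then obtain u v w where "x = cls u" "y = cls v" "z = cls w"
    and "u \<in> amalg_words M1 M2" "v \<in> amalg_words M1 M2" "w \<in> amalg_words M1 M2"
    unfolding carrier_A by blast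
  then show "x \<otimes>\<^bsub>A\<^esub> y \<otimes>\<^bsub>A\<^esub> z = x \<otimes>\<^bsub>A\<^esub> (y \<otimes>\<^bsub>A\<^esub> z)"
    by (simp add: mult_cls)
next
  fix x assume "x \<in> carrier A"
  then obtain u where x: "x = cls u" "u \<in> amalg_words M1 M2" unfolding carrier_A by blast
  then show "\<one>\<^bsub>A\<^esub> \<otimes>\<^bsub>A\<^esub> x = x" "x \<otimes>\<^bsub>A\<^esub> \<one>\<^bsub>A\<^esub> = x"
    using mult_cls[of "[]" u] mult_cls[of u "[]"] by (simp_all add: one_A)
qed

lemma inl_hom: "inl \<in> monoid_hom M1 A"
proof -
  have "inl (x \<otimes>\<^bsub>M1\<^esub> y) = inl x \<otimes>\<^bsub>A\<^esub> inl y" if "x \<in> carrier M1" "y \<in> carrier M1" for x y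
    using that mult_cls[of "[Inl x]" "[Inl y]"] cls_eqI[OF amalg_eq.mult1[OF that]]
    by (simp add: amalg_inl_def)
  moreover have "inl \<one>\<^bsub>M1\<^esub> = \<one>\<^bsub>A\<^esub>"
    using cls_eqI[OF amalg_eq.one1] by (simp add: amalg_inl_def one_A)
  ultimately show ?thesis
    by (auto simp: monoid_hom_def hom_def amalg_inl_def carrier_A)
qed

lemma inr_hom: "inr \<in> monoid_hom M2 A"
proof -
  have "inr (x \<otimes>\<^bsub>M2\<^esub> y) = inr x \<otimes>\<^bsub>A\<^esub> inr y" if "x \<in> carrier M2" "y \<in> carrier M2" for x y
    using that mult_cls[of "[Inr x]" "[Inr y]"] cls_eqI[OF amalg_eq.mult2[OF that]]
    by (simp add: amalg_inr_def)
  moreover have "inr \<one>\<^bsub>M2\<^esub> = \<one>\<^bsub>A\<^esub>"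
    using cls_eqI[OF amalg_eq.one2] by (simp add: amalg_inr_def one_A)
  ultimately show ?thesis
    by (auto simp: monoid_hom_def hom_def amalg_inr_def carrier_A)
qed

lemma inl_inr_glue: "n \<in> carrier N \<Longrightarrow> inl (\<iota>1 n) = inr (\<iota>2 n)"
  unfolding amalg_inl_def amalg_inr_def by (rule cls_eqI[OF amalg_eq.glue])

context
  fixes P :: "('d, 'm) monoid_scheme" and f g
  assumes P: "monoid P" and f: "f \<in> monoid_hom M1 P" and g: "g \<in> monoid_hom M2 P"
    and fg: "\<And>n. n \<in> carrier N \<Longrightarrow> f (\<iota>1 n) = g (\<iota>2 n)"
begin

lemma letter_closed:
  "x \<in> carrier M1 \<Longrightarrow> f x \<in> carrier P" "y \<in> carrier M2 \<Longrightarrow> g y \<in> carrier P"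
  using f g by (auto simp: monoid_hom_def hom_def)

lemma word_eval_Nil: "word_eval P f g [] = \<one>\<^bsub>P\<^esub>"
  and word_eval_Cons: "word_eval P f g (l # w) = case_sum f g l \<otimes>\<^bsub>P\<^esub> word_eval P f g w"
  by (simp_all add: word_eval_def)

lemma word_eval_closed: "w \<in> amalg_words M1 M2 \<Longrightarrow> word_eval P f g w \<in> carrier P"
proof (induction w)
  case Nil
  then show ?case using P by (simp add: word_eval_Nil monoid.one_closed)
next
  case (Cons l w)
  then show ?case using P letter_closed
    by (cases l) (auto simp: word_eval_Cons intro!: monoid.m_closed)
qed

lemma word_eval_append:
  assumes "u \<in> amalg_words M1 M2" "v \<in> amalg_words M1 M2"
  shows "word_eval P f g (u @ v) = word_eval P f g u \<otimes>\<^bsub>P\<^esub> word_eval P f g v"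
  using assms(1)
proof (induction u)
  case Nil
  then show ?case using P word_eval_closed[OF assms(2)]
    by (simp add: word_eval_Nil monoid.l_one)
next
  case (Cons l u)
  then have "case_sum f g l \<in> carrier P" "u \<in> amalg_words M1 M2"
    using letter_closed by (cases l; auto)+
  then show ?case
    using Cons.IH P word_eval_closed assms(2) by (simp add: word_eval_Cons monoid.m_assoc)
qed

lemma word_eval_single:
  shows "x \<in> carrier M1 \<Longrightarrow> word_eval P f g [Inl x] = f x"
    and "y \<in> carrier M2 \<Longrightarrow> word_eval P f g [Inr y] = g y"
  using P letter_closed by (simp_all add: word_eval_Cons word_eval_Nil monoid.r_one)

lemma word_eval_eqv: "eqv u v \<Longrightarrow> word_eval P f g u = word_eval P f g v"
proof (induction rule: amalg_eq.induct)
  case (append u u' v v')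
  then show ?case using eqv_words by (simp add: word_eval_append)
next
  case (mult1 x y)
  then have "word_eval P f g [Inl x, Inl y] = f x \<otimes>\<^bsub>P\<^esub> f y"
    using word_eval_append[of "[Inl x]" "[Inl y]"] by (simp add: word_eval_single)
  also have "\<dots> = f (x \<otimes>\<^bsub>M1\<^esub> y)" using f mult1 by (auto simp: monoid_hom_def hom_def)
  finally show ?case using mult1 M1 by (simp add: word_eval_single monoid.m_closed)
next
  case (mult2 x y)
  then have "word_eval P f g [Inr x, Inr y] = g x \<otimes>\<^bsub>P\<^esub> g y"
    using word_eval_append[of "[Inr x]" "[Inr y]"] by (simp add: word_eval_single)
  also have "\<dots> = g (x \<otimes>\<^bsub>M2\<^esub> y)" using g mult2 by (auto simp: monoid_hom_def hom_def)
  finally show ?case using mult2 M2 by (simp add: word_eval_single monoid.m_closed)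
next
  case one1
  then show ?case using f M1
    by (simp add: word_eval_single word_eval_Nil monoid.one_closed monoid_hom_def)
next
  case one2
  then show ?case using g M2
    by (simp add: word_eval_single word_eval_Nil monoid.one_closed monoid_hom_def)
next
  case (glue n)
  then have "\<iota>1 n \<in> carrier M1" "\<iota>2 n \<in> carrier M2" using \<iota>1 \<iota>2 by auto
  then show ?case using fg[OF glue] by (simp add: word_eval_single)
qed simp_all

lemma amalg_lift_cls:
  assumes "w \<in> amalg_words M1 M2"
  shows "amalg_lift P f g (cls w) = word_eval P f g w"
proof -
  have "word_eval P f g ` cls w = {word_eval P f g w}"
  proof (intro equalityI subsetI)
    fix p assume "p \<in> word_eval P f g ` cls w"
    then obtain v where "p = word_eval P f g v" "eqv w v"
      unfolding amalg_class_def by (elim imageE) simp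
    then show "p \<in> {word_eval P f g w}" using word_eval_eqv[of w v] by simp
  next
    fix p assume "p \<in> {word_eval P f g w}"
    then show "p \<in> word_eval P f g ` cls w" using cls_self[OF assms] by simp
  qed
  then show ?thesis by (simp add: amalg_lift_def)
qed

lemma amalg_lift_hom: "amalg_lift P f g \<in> monoid_hom A P"
proof -
  have "amalg_lift P f g \<in> carrier A \<rightarrow> carrier P"
    using word_eval_closed by (auto simp: carrier_A amalg_lift_cls)
  moreover have "amalg_lift P f g (x \<otimes>\<^bsub>A\<^esub> y) = amalg_lift P f g x \<otimes>\<^bsub>P\<^esub> amalg_lift P f g y"
    if "x \<in> carrier A" "y \<in> carrier A" for x y
    using that word_eval_append
    by (auto simp: carrier_A mult_cls amalg_lift_cls)
  moreover have "amalg_lift P f g \<one>\<^bsub>A\<^esub> = \<one>\<^bsub>P\<^esub>"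
    using amalg_lift_cls[of "[]"] by (simp add: one_A word_eval_def)
  ultimately show ?thesis by (simp add: monoid_hom_def hom_def)
qed

lemma amalg_lift_inl: "x \<in> carrier M1 \<Longrightarrow> amalg_lift P f g (inl x) = f x"
  by (simp add: amalg_inl_def amalg_lift_cls word_eval_single)

lemma amalg_lift_inr: "y \<in> carrier M2 \<Longrightarrow> amalg_lift P f g (inr y) = g y"
  by (simp add: amalg_inr_def amalg_lift_cls word_eval_single)

lemma amalg_lift_unique:
  assumes h: "h \<in> monoid_hom A P"
    and "\<And>x. x \<in> carrier M1 \<Longrightarrow> h (inl x) = f x"
    and "\<And>y. y \<in> carrier M2 \<Longrightarrow> h (inr y) = g y"
    and "X \<in> carrier A"
  shows "h X = amalg_lift P f g X"
proof -
  have "h (cls w) = word_eval P f g w" if "w \<in> amalg_words M1 M2" for w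
    using that
  proof (induction w)
    case Nil
    then show ?case using h by (simp add: monoid_hom_def one_A word_eval_def)
  next
    case (Cons l w)
    then have l: "[l] \<in> amalg_words M1 M2" and w: "w \<in> amalg_words M1 M2"
      by (cases l; auto)+
    have "h (cls [l] \<otimes>\<^bsub>A\<^esub> cls w) = h (cls [l]) \<otimes>\<^bsub>P\<^esub> h (cls w)"
      using h l w by (auto simp: monoid_hom_def hom_def carrier_A)
    then have "h (cls (l # w)) = h (cls [l]) \<otimes>\<^bsub>P\<^esub> h (cls w)"
      using mult_cls[OF l w] by simp
    moreover have "h (cls [l]) = case_sum f g l"
      using l assms(2,3) by (cases l) (auto simp: amalg_inl_def amalg_inr_def)
    ultimately show ?case using Cons.IH[OF w] by (simp add: word_eval_def)
  qed
  moreover obtain w where "X = cls w" "w \<in> amalg_words M1 M2"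
    using assms(4) unfolding carrier_A by (elim imageE)
  ultimately show ?thesis by (simp add: amalg_lift_cls)
qed

end

end

end

theory Submission
  imports Defs
begin

text \<open>
Everything rests on one fact about a parabolic submonoid \<open>N\<close> of a preGarside monoid \<open>M\<close>: each
element has a greatest left divisor in \<open>N\<close>, so that \<open>M\<close> is a free left \<open>N\<close>-act
(\<open>parabolic_left_free\<close>). Consequently the elements of \<open>M1 *\<^sub>N M2\<close> have unique normal forms
\<open>n s\<^sub>1 \<dots> s\<^sub>r\<close> with \<open>n\<close> in \<open>N\<close> and the \<open>s\<^sub>k\<close> nontrivial basis elements taken alternately from
\<open>M1\<close> and \<open>M2\<close>. Absorbing \<open>n\<close> into the first syllable shows that the amalgam is free as a left act
over each factor \<open>M\<^sub>i\<close>; hence for every \<open>d\<close> there is \<open>p\<close> in \<open>M\<^sub>i\<close> such that the left divisors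
of \<open>d\<close> lying in \<open>M\<^sub>i\<close> are exactly the left divisors of \<open>p\<close> (\<open>letter_divides_iff\<close>). Statements
about right divisors follow by reading words backwards, which exchanges the amalgam with that of the
opposite monoids.

For the first part, let \<open>P\<close> be the set of letters from \<open>M1'\<close> and \<open>M2'\<close>. Since \<open>M1'\<close> and
\<open>M2'\<close> are closed under factors and have the same trace on \<open>N\<close>, no defining relation of the
amalgam relates a word over \<open>P\<close> to one that is not (\<open>eqv_lists_P\<close>); so the submonoid generated by
\<open>P\<close> is closed under factors. The canonical map is injective because the normal form of a word over
\<open>P\<close> can be computed inside \<open>P\<close> (\<open>nf_determines_eval\<close>). As for joins, closure under factors
reduces the claim to this: two elements of the submonoid that have a common multiple in the amalgam
have one in the submonoid (\<open>common_multiple_L\<close>). For two letters from the same factor this is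
parabolicity there, by the divisor statement above. If the letters \<open>x\<close> and \<open>y\<close> come from different
factors and both divide \<open>d\<close>, then the normal form of \<open>d\<close> starts in at most one of these factors,
which forces one of the letters into \<open>N\<close>, hence into both factors. The step from letters to arbitrary
elements is a Noetherian induction (\<open>directed_divisors\<close>), whose measure combines the syllable length
with the norm of the first syllable; this avoids having to reconcile the norms of \<open>M1\<close> and \<open>M2\<close>
on \<open>N\<close>.

For the second part, the divisor statement says that a join formed in \<open>M\<^sub>i\<close> is still a join in the
amalgam, so that the trace of \<open>M'\<close> on \<open>M\<^sub>i\<close> is parabolic (\<open>parabolic_vimage\<close>). Closure of \<open>M'\<close>
under factors shows that \<open>M'\<close> consists of the products of letters that it contains, and the first
part identifies the submonoid of these products with an amalgam.
\<close>

section \<open>Divisibility and parabolic submonoids\<close>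

definition op_monoid :: "'a monoid \<Rightarrow> 'a monoid"
  where "op_monoid M = M\<lparr>mult := \<lambda>x y. y \<otimes>\<^bsub>M\<^esub> x\<rparr>"

lemma op_monoid_simps [simp]:
  "carrier (op_monoid M) = carrier M" "\<one>\<^bsub>op_monoid M\<^esub> = \<one>\<^bsub>M\<^esub>"
  "x \<otimes>\<^bsub>op_monoid M\<^esub> y = y \<otimes>\<^bsub>M\<^esub> x" "op_monoid (op_monoid M) = M"
  by (simp_all add: op_monoid_def)

lemma le_op_monoid [simp]: "le_L (op_monoid M) = le_R M" "le_R (op_monoid M) = le_L M"
  by (simp_all add: le_L_def le_R_def fun_eq_iff)

lemma monoid_op_monoid: "monoid M \<Longrightarrow> monoid (op_monoid M)"
  by (rule monoidI) (simp_all add: monoid.m_assoc monoid.m_closed monoid.one_closed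
      monoid.l_one monoid.r_one)

lemma preGarside_op_monoid:
  assumes "preGarside M"
  shows "preGarside (op_monoid M)"
proof -
  have M: "monoid M" using assms by (simp add: preGarside_def)
  have "cancellative (op_monoid M)"
    unfolding cancellative_def
  proof (intro ballI impI)
    fix a b c d
    assume *: "a \<in> carrier (op_monoid M)" "b \<in> carrier (op_monoid M)"
      "c \<in> carrier (op_monoid M)" "d \<in> carrier (op_monoid M)"
      "c \<otimes>\<^bsub>op_monoid M\<^esub> a \<otimes>\<^bsub>op_monoid M\<^esub> d = c \<otimes>\<^bsub>op_monoid M\<^esub> b \<otimes>\<^bsub>op_monoid M\<^esub> d"
    then have "d \<otimes>\<^bsub>M\<^esub> a \<otimes>\<^bsub>M\<^esub> c = d \<otimes>\<^bsub>M\<^esub> b \<otimes>\<^bsub>M\<^esub> c"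
      using M by (simp add: monoid.m_assoc)
    then show "a = b"
      using assms * unfolding preGarside_def cancellative_def by simp blast
  qed
  moreover have "atomic (op_monoid M)"
  proof -
    obtain \<nu> where "\<forall>a \<in> carrier M. a \<noteq> \<one>\<^bsub>M\<^esub> \<longrightarrow> \<nu> a > (0::nat)"
      "\<forall>a \<in> carrier M. \<forall>b \<in> carrier M. \<nu> (a \<otimes>\<^bsub>M\<^esub> b) \<ge> \<nu> a + \<nu> b"
      using assms unfolding preGarside_def atomic_def by blast
    then have "\<forall>a \<in> carrier M. \<forall>b \<in> carrier M. \<nu> (b \<otimes>\<^bsub>M\<^esub> a) \<ge> \<nu> a + \<nu> b"
      by (subst add.commute) blast
    with \<open>\<forall>a \<in> carrier M. _ \<longrightarrow> _\<close> show ?thesis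
      unfolding atomic_def by (intro exI[of _ \<nu>]) simp
  qed
  ultimately show ?thesis
    using assms monoid_op_monoid[OF M] by (simp add: preGarside_def)
qed

lemma preGarside_l_cancel:
  assumes "preGarside M" "a \<in> carrier M" "b \<in> carrier M" "c \<in> carrier M"
    and "c \<otimes>\<^bsub>M\<^esub> a = c \<otimes>\<^bsub>M\<^esub> b"
  shows "a = b"
proof -
  have "monoid M" using assms by (simp add: preGarside_def)
  then have "c \<otimes>\<^bsub>M\<^esub> a \<otimes>\<^bsub>M\<^esub> \<one>\<^bsub>M\<^esub> = c \<otimes>\<^bsub>M\<^esub> b \<otimes>\<^bsub>M\<^esub> \<one>\<^bsub>M\<^esub>" "\<one>\<^bsub>M\<^esub> \<in> carrier M"
    using assms by (simp_all add: monoid.one_closed)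
  then show ?thesis using assms(1-4) unfolding preGarside_def cancellative_def by blast
qed

lemma parabolicD:
  assumes "parabolic P M"
  shows "submonoid P M" "P \<subseteq> carrier M" "\<one>\<^bsub>M\<^esub> \<in> P"
    and "\<And>a b. a \<in> P \<Longrightarrow> b \<in> P \<Longrightarrow> a \<otimes>\<^bsub>M\<^esub> b \<in> P"
    and "\<And>a b. a \<in> carrier M \<Longrightarrow> b \<in> carrier M \<Longrightarrow> a \<otimes>\<^bsub>M\<^esub> b \<in> P \<Longrightarrow> a \<in> P \<and> b \<in> P"
proof -
  show P: "submonoid P M" using assms unfolding parabolic_def by (elim conjE)
  show "P \<subseteq> carrier M" "\<one>\<^bsub>M\<^esub> \<in> P" "\<And>a b. a \<in> P \<Longrightarrow> b \<in> P \<Longrightarrow> a \<otimes>\<^bsub>M\<^esub> b \<in> P"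
    by (rule submonoid.subset[OF P] submonoid.one_closed[OF P] submonoid.m_closed[OF P]; assumption?)+
  have "\<forall>a \<in> carrier M. \<forall>b \<in> carrier M. a \<otimes>\<^bsub>M\<^esub> b \<in> P \<longrightarrow> a \<in> P \<and> b \<in> P"
    using assms unfolding parabolic_def by (elim conjE)
  then show "\<And>a b. a \<in> carrier M \<Longrightarrow> b \<in> carrier M \<Longrightarrow> a \<otimes>\<^bsub>M\<^esub> b \<in> P \<Longrightarrow> a \<in> P \<and> b \<in> P"
    by blast
qed

lemma submonoid_op_monoid: "submonoid P M \<Longrightarrow> submonoid P (op_monoid M)"
  by (simp add: submonoid_def)

lemma parabolic_op_monoid:
  assumes "parabolic P M"
  shows "parabolic P (op_monoid M)"
proof -
  have "a \<in> P \<and> b \<in> P" if "a \<in> carrier M" "b \<in> carrier M" "b \<otimes>\<^bsub>M\<^esub> a \<in> P" for a b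
    using parabolicD(5)[OF assms that(2,1,3)] by simp
  moreover have "\<forall>a \<in> P. \<forall>b \<in> P. \<forall>c. is_join (le_L M) (carrier M) a b c \<longrightarrow> c \<in> P"
    "\<forall>a \<in> P. \<forall>b \<in> P. \<forall>c. is_join (le_R M) (carrier M) a b c \<longrightarrow> c \<in> P"
    using assms unfolding parabolic_def by - (elim conjE, assumption)+
  ultimately show ?thesis
    using submonoid_op_monoid[OF parabolicD(1)[OF assms]]
    unfolding parabolic_def op_monoid_simps le_op_monoid by (intro conjI ballI impI) blast+
qed

lemma parabolic_embedding_op_monoid:
  "parabolic_embedding h N M \<Longrightarrow> parabolic_embedding h (op_monoid N) (op_monoid M)"
  unfolding parabolic_embedding_def monoid_hom_def hom_def by (simp add: parabolic_op_monoid Pi_def)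

lemma parabolic_mult_iff:
  assumes "parabolic P M" "a \<in> carrier M" "b \<in> carrier M"
  shows "a \<otimes>\<^bsub>M\<^esub> b \<in> P \<longleftrightarrow> a \<in> P \<and> b \<in> P"
  using parabolicD(4,5)[OF assms(1)] assms(2,3) by blast

text \<open>The common multiple \<open>d\<close> ensures that the join of \<open>a\<close> and \<open>b\<close> exists, and it serves as \<open>c\<close>. The
conclusion speaks of common multiples only, the notion in which the induction over the amalgam is carried out.\<close>

lemma parabolic_directed:
  assumes "preGarside M" "parabolic P M" "a \<in> P" "b \<in> P" "d \<in> carrier M"
    and "le_L M a d" "le_L M b d"
  shows "\<exists>c \<in> P. le_L M a c \<and> le_L M b c \<and> le_L M c d"
proof -
  have "a \<in> carrier M" "b \<in> carrier M" using assms parabolicD(2) by blast+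
  then obtain c where c: "is_join (le_L M) (carrier M) a b c"
    using assms unfolding preGarside_def by blast
  then have "c \<in> P" using assms unfolding parabolic_def by blast
  with c show ?thesis using assms unfolding is_join_def by blast
qed

lemma parabolic_carrier: "monoid M \<Longrightarrow> parabolic (carrier M) M"
  unfolding parabolic_def is_join_def by (auto simp: submonoid_def monoid.m_closed monoid.one_closed)

lemma parabolic_embeddingD:
  assumes "parabolic_embedding h N M"
  shows "h \<in> monoid_hom N M" "inj_on h (carrier N)" "parabolic (h ` carrier N) M"
    and "\<And>n. n \<in> carrier N \<Longrightarrow> h n \<in> carrier M"
    and "\<And>m n. m \<in> carrier N \<Longrightarrow> n \<in> carrier N \<Longrightarrow> h (m \<otimes>\<^bsub>N\<^esub> n) = h m \<otimes>\<^bsub>M\<^esub> h n"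
    and "h \<one>\<^bsub>N\<^esub> = \<one>\<^bsub>M\<^esub>"
  using assms by (auto simp: parabolic_embedding_def monoid_hom_def hom_def)

text \<open>These elements form the basis of \<open>M\<close> as a left \<open>N\<close>-act.\<close>

definition transversal :: "('c \<Rightarrow> 'a) \<Rightarrow> 'c monoid \<Rightarrow> 'a monoid \<Rightarrow> 'a set"
  where "transversal h N M =
    {s \<in> carrier M. \<forall>n \<in> carrier N. le_L M (h n) s \<longrightarrow> n = \<one>\<^bsub>N\<^esub>}"

text \<open>A factorization \<open>a = n s\<close> with \<open>n\<close> of maximal norm leaves an \<open>s\<close> without nontrivial left divisors from
\<open>N\<close>. For uniqueness, two candidates \<open>n\<close> and \<open>n'\<close> have a common multiple \<open>c\<close> in \<open>N\<close> dividing \<open>a\<close>;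
writing \<open>c = n k\<close>, the factor \<open>k\<close> lies in \<open>N\<close> and divides \<open>s\<close>, whence \<open>c = n\<close>, and likewise
\<open>c = n'\<close>.\<close>

lemma parabolic_left_free:
  assumes M: "preGarside M" and N: "monoid N" and h: "parabolic_embedding h N M"
  shows "bij_betw (\<lambda>(n, s). h n \<otimes>\<^bsub>M\<^esub> s) (carrier N \<times> transversal h N M) (carrier M)"
proof -
  interpret M: monoid M using M by (simp add: preGarside_def)
  interpret N: monoid N by (rule N)
  note hD = parabolic_embeddingD[OF h]
  obtain \<nu> where \<nu>: "\<And>a. a \<in> carrier M \<Longrightarrow> a \<noteq> \<one>\<^bsub>M\<^esub> \<Longrightarrow> \<nu> a > (0::nat)"
    "\<And>a b. a \<in> carrier M \<Longrightarrow> b \<in> carrier M \<Longrightarrow> \<nu> (a \<otimes>\<^bsub>M\<^esub> b) \<ge> \<nu> a + \<nu> b"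
    using M unfolding preGarside_def atomic_def by blast
  have trivial: "n = \<one>\<^bsub>N\<^esub>" if "n \<in> carrier N" "h n = \<one>\<^bsub>M\<^esub>" for n
    using that hD(2,6) by (metis N.one_closed inj_onD)
  have exhaust: "\<exists>n \<in> carrier N. \<exists>s \<in> transversal h N M. a = h n \<otimes>\<^bsub>M\<^esub> s"
    if a: "a \<in> carrier M" for a
  proof -
    let ?D = "\<lambda>n. n \<in> carrier N \<and> le_L M (h n) a"
    have bound: "\<nu> (h n) < Suc (\<nu> a)" if "?D n" for n
    proof -
      from that obtain c where "c \<in> carrier M" "a = h n \<otimes>\<^bsub>M\<^esub> c" by (auto simp: le_L_def)
      then show ?thesis using \<nu>(2)[of "h n" c] that hD(4) by simp
    qed
    moreover have "?D \<one>\<^bsub>N\<^esub>" using a hD(6) by (auto simp: le_L_def)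
    ultimately obtain n where n: "?D n" and max: "\<And>m. ?D m \<Longrightarrow> \<nu> (h m) \<le> \<nu> (h n)"
      using ex_has_greatest_nat[of ?D "\<one>\<^bsub>N\<^esub>" "\<lambda>n. \<nu> (h n)" "Suc (\<nu> a)"]
      by blast
    from n obtain s where s: "s \<in> carrier M" "a = h n \<otimes>\<^bsub>M\<^esub> s" by (auto simp: le_L_def)
    have "m = \<one>\<^bsub>N\<^esub>" if m: "m \<in> carrier N" "le_L M (h m) s" for m
    proof (rule ccontr)
      assume "m \<noteq> \<one>\<^bsub>N\<^esub>"
      from m obtain r where r: "r \<in> carrier M" "s = h m \<otimes>\<^bsub>M\<^esub> r" by (auto simp: le_L_def)
      have "a = h (n \<otimes>\<^bsub>N\<^esub> m) \<otimes>\<^bsub>M\<^esub> r" using s r n m hD(4) by (simp add: hD(5) M.m_assoc)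
      then have "?D (n \<otimes>\<^bsub>N\<^esub> m)" using n m r by (auto simp: le_L_def)
      then have "\<nu> (h n \<otimes>\<^bsub>M\<^esub> h m) \<le> \<nu> (h n)" using max[of "n \<otimes>\<^bsub>N\<^esub> m"] n m by (simp add: hD(5))
      then have "\<nu> (h m) = 0" using \<nu>(2)[of "h n" "h m"] n m hD(4) by simp
      then show False using \<nu>(1)[of "h m"] trivial m \<open>m \<noteq> \<one>\<^bsub>N\<^esub>\<close> hD(4) by fastforce
    qed
    then show ?thesis using s n by (auto simp: transversal_def)
  qed
  have absorbs: "c = h n"
    if "n \<in> carrier N" "s \<in> transversal h N M" "c \<in> h ` carrier N" "le_L M (h n) c"
      "le_L M c (h n \<otimes>\<^bsub>M\<^esub> s)" for n s c
  proof -
    from that obtain k r where k: "k \<in> carrier M" "c = h n \<otimes>\<^bsub>M\<^esub> k"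
      and r: "r \<in> carrier M" "h n \<otimes>\<^bsub>M\<^esub> s = c \<otimes>\<^bsub>M\<^esub> r" by (auto simp: le_L_def)
    have "k \<in> h ` carrier N"
      using parabolicD(5)[OF hD(3), of "h n" k] that(1,3) k hD(4) by simp
    then obtain m where m: "m \<in> carrier N" "k = h m" by blast
    have s: "s \<in> carrier M" using that by (simp add: transversal_def)
    have "h n \<otimes>\<^bsub>M\<^esub> s = h n \<otimes>\<^bsub>M\<^esub> (k \<otimes>\<^bsub>M\<^esub> r)"
      using k r that(1) hD(4) by (simp add: M.m_assoc)
    then have "s = k \<otimes>\<^bsub>M\<^esub> r"
      using preGarside_l_cancel[OF M, of s "k \<otimes>\<^bsub>M\<^esub> r" "h n"] s k r that(1) hD(4) by simp
    then have "m = \<one>\<^bsub>N\<^esub>" using that(2) m r by (auto simp: transversal_def le_L_def)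
    then show ?thesis using k m that(1) hD(4,6) by simp
  qed
  have unique: "n = n' \<and> s = s'"
    if n: "n \<in> carrier N" "n' \<in> carrier N" and s: "s \<in> transversal h N M" "s' \<in> transversal h N M"
      and eq: "h n \<otimes>\<^bsub>M\<^esub> s = h n' \<otimes>\<^bsub>M\<^esub> s'" for n n' s s'
  proof -
    have sM: "s \<in> carrier M" "s' \<in> carrier M" using s by (simp_all add: transversal_def)
    have "le_L M (h n) (h n \<otimes>\<^bsub>M\<^esub> s)" "le_L M (h n') (h n \<otimes>\<^bsub>M\<^esub> s)"
      using sM eq unfolding le_L_def by blast+
    moreover have "h n \<otimes>\<^bsub>M\<^esub> s \<in> carrier M" using sM n hD(4) by simp
    ultimately obtain c where "c \<in> h ` carrier N" "le_L M (h n) c" "le_L M (h n') c"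
      "le_L M c (h n \<otimes>\<^bsub>M\<^esub> s)"
      using parabolic_directed[OF M hD(3), of "h n" "h n'"] n by blast
    then have "h n = h n'" using absorbs[of n s c] absorbs[of n' s' c] n s eq by simp
    then show ?thesis
      using preGarside_l_cancel[OF M, of s s' "h n"] n sM eq hD(4) inj_onD[OF hD(2), of n n'] by simp
  qed
  show ?thesis
    unfolding bij_betw_def
  proof
    show "inj_on (\<lambda>(n, s). h n \<otimes>\<^bsub>M\<^esub> s) (carrier N \<times> transversal h N M)"
      using unique by (fastforce simp: inj_on_def)
    have "h n \<otimes>\<^bsub>M\<^esub> s \<in> carrier M" if "n \<in> carrier N" "s \<in> transversal h N M" for n s
      using that hD(4) by (simp add: transversal_def)
    then show "(\<lambda>(n, s). h n \<otimes>\<^bsub>M\<^esub> s) ` (carrier N \<times> transversal h N M) = carrier M"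
      using exhaust by fastforce
  qed
qed

text \<open>Factoring \<open>1 = n s\<close> with \<open>s\<close> in the transversal puts \<open>s\<close> into \<open>N\<close>, where it divides itself, so
that \<open>s = 1\<close>.\<close>

lemma one_in_transversal:
  assumes M: "preGarside M" and N: "monoid N" and h: "parabolic_embedding h N M"
  shows "\<one>\<^bsub>M\<^esub> \<in> transversal h N M"
proof -
  interpret M: monoid M using M by (simp add: preGarside_def)
  note hD = parabolic_embeddingD[OF h]
  have "\<one>\<^bsub>M\<^esub> \<in> (\<lambda>(n, s). h n \<otimes>\<^bsub>M\<^esub> s) ` (carrier N \<times> transversal h N M)"
    using parabolic_left_free[OF assms] by (simp add: bij_betw_def)
  then obtain n s where ns: "n \<in> carrier N" "s \<in> transversal h N M" "\<one>\<^bsub>M\<^esub> = h n \<otimes>\<^bsub>M\<^esub> s" by auto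
  then have s: "s \<in> carrier M" by (simp add: transversal_def)
  have "s \<in> h ` carrier N"
    using parabolicD(3)[OF hD(3)] parabolicD(5)[OF hD(3), of "h n" s] ns s hD(4) by simp
  then obtain m where "m \<in> carrier N" "s = h m" by blast
  moreover have "le_L M s s" using s unfolding le_L_def by (intro bexI[of _ "\<one>\<^bsub>M\<^esub>"]) simp_all
  ultimately have "m = \<one>\<^bsub>N\<^esub>" using ns(2) by (simp add: transversal_def)
  then show ?thesis using \<open>s = h m\<close> ns(2) hD(6) by simp
qed

section \<open>Normal forms\<close>

text \<open>A family of monoids with disjoint carriers in one type of letters, all containing copies of \<open>N\<close> over
which they are free as left acts with a basis containing 1. The amalgam is studied here through its
action on normal forms, which treats all factors alike.\<close>

locale left_free_family =
  fixes F :: "'i \<Rightarrow> 'l monoid" and N :: "'c monoid" and e :: "'i \<Rightarrow> 'c \<Rightarrow> 'l"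
    and S :: "'i \<Rightarrow> 'l set" and side :: "'l \<Rightarrow> 'i"
  assumes F: "\<And>i. monoid (F i)" and N: "monoid N" and e: "\<And>i. e i \<in> monoid_hom N (F i)"
    and one_S: "\<And>i. \<one>\<^bsub>F i\<^esub> \<in> S i" and S_carrier: "\<And>i. S i \<subseteq> carrier (F i)"
    and free: "\<And>i. bij_betw (\<lambda>(n, s). e i n \<otimes>\<^bsub>F i\<^esub> s) (carrier N \<times> S i) (carrier (F i))"
    and side: "\<And>x i. x \<in> carrier (F i) \<Longrightarrow> side x = i"
begin

sublocale F: monoid "F i" for i by (rule F)
sublocale N: monoid N by (rule N)

lemma e_closed [simp]: "n \<in> carrier N \<Longrightarrow> e i n \<in> carrier (F i)"
  and e_mult: "m \<in> carrier N \<Longrightarrow> n \<in> carrier N \<Longrightarrow> e i (m \<otimes>\<^bsub>N\<^esub> n) = e i m \<otimes>\<^bsub>F i\<^esub> e i n"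
  and e_one [simp]: "e i \<one>\<^bsub>N\<^esub> = \<one>\<^bsub>F i\<^esub>"
  using e[of i] by (auto simp: monoid_hom_def hom_def)

lemma S_closed [simp]: "s \<in> S i \<Longrightarrow> s \<in> carrier (F i)"
  using S_carrier by blast

lemma side_S: "s \<in> S i \<Longrightarrow> side s = i"
  using side by simp

definition decomp :: "'i \<Rightarrow> 'l \<Rightarrow> 'c \<times> 'l"
  where "decomp i = inv_into (carrier N \<times> S i) (\<lambda>(n, s). e i n \<otimes>\<^bsub>F i\<^esub> s)"

lemma decomp_mult [simp]:
  "n \<in> carrier N \<Longrightarrow> s \<in> S i \<Longrightarrow> decomp i (e i n \<otimes>\<^bsub>F i\<^esub> s) = (n, s)"
  using inv_into_f_f[OF bij_betw_imp_inj_on[OF free[of i]], of "(n, s)"] by (simp add: decomp_def)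

lemma decomp_e [simp]: "n \<in> carrier N \<Longrightarrow> decomp i (e i n) = (n, \<one>\<^bsub>F i\<^esub>)"
  using decomp_mult[of n "\<one>\<^bsub>F i\<^esub>" i] one_S by simp

lemma decompE:
  assumes "a \<in> carrier (F i)"
  obtains n s where "n \<in> carrier N" "s \<in> S i" "a = e i n \<otimes>\<^bsub>F i\<^esub> s"
proof -
  have "a \<in> (\<lambda>(n, s). e i n \<otimes>\<^bsub>F i\<^esub> s) ` (carrier N \<times> S i)"
    using free[of i] assms by (simp add: bij_betw_def)
  then show ?thesis using that by auto
qed

definition starts :: "'i \<Rightarrow> 'l list \<Rightarrow> bool"
  where "starts i w \<longleftrightarrow> w \<noteq> [] \<and> side (hd w) = i"

definition reduced :: "'l list \<Rightarrow> bool"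
  where "reduced w \<longleftrightarrow>
    (\<forall>s \<in> set w. s \<in> S (side s) \<and> s \<noteq> \<one>\<^bsub>F (side s)\<^esub>) \<and> distinct_adj (map side w)"

text \<open>The pair \<open>(n, s\<^sub>1 \<dots> s\<^sub>r)\<close> stands for the product \<open>n s\<^sub>1 \<dots> s\<^sub>r\<close>.\<close>

definition states :: "('c \<times> 'l list) set"
  where "states = carrier N \<times> Collect reduced"

text \<open>\<open>peel i\<close> and \<open>attach i\<close> are mutually inverse bijections between the normal forms and the pairs of an
element of \<open>F i\<close> and a reduced word not starting in \<open>F i\<close>. Through them \<open>F i\<close> acts on normal forms
by left multiplication on the first component, and the action is visibly free.\<close>

fun peel :: "'i \<Rightarrow> 'c \<times> 'l list \<Rightarrow> 'l \<times> 'l list"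
  where "peel i (n, w) = (if starts i w then (e i n \<otimes>\<^bsub>F i\<^esub> hd w, tl w) else (e i n, w))"

fun attach :: "'i \<Rightarrow> 'l \<times> 'l list \<Rightarrow> 'c \<times> 'l list"
  where "attach i (a, w) = (let (n, s) = decomp i a in (n, if s = \<one>\<^bsub>F i\<^esub> then w else s # w))"

definition peeled :: "'i \<Rightarrow> ('l \<times> 'l list) set"
  where "peeled i = carrier (F i) \<times> {w. reduced w \<and> \<not> starts i w}"

definition act :: "'l \<Rightarrow> 'c \<times> 'l list \<Rightarrow> 'c \<times> 'l list"
  where "act x \<sigma> = (let i = side x; (a, w) = peel i \<sigma> in attach i (x \<otimes>\<^bsub>F i\<^esub> a, w))"

definition run :: "'l list \<Rightarrow> 'c \<times> 'l list \<Rightarrow> 'c \<times> 'l list"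
  where "run = foldr act"

definition nf :: "'l list \<Rightarrow> 'c \<times> 'l list"
  where "nf w = run w (\<one>\<^bsub>N\<^esub>, [])"

lemma reduced_Nil [simp]: "reduced []"
  by (simp add: reduced_def)

lemma not_starts_Nil [simp]: "\<not> starts i []"
  by (simp add: starts_def)

lemma starts_Cons [simp]: "starts i (s # w) \<longleftrightarrow> side s = i"
  by (simp add: starts_def)

lemma reduced_Cons [simp]:
  "reduced (s # w) \<longleftrightarrow>
    s \<in> S (side s) \<and> s \<noteq> \<one>\<^bsub>F (side s)\<^esub> \<and> \<not> starts (side s) w \<and> reduced w"
  by (cases w) (auto simp: reduced_def)

lemma peel_in_peeled: "\<sigma> \<in> states \<Longrightarrow> peel i \<sigma> \<in> peeled i"
  by (cases \<sigma>; cases "snd \<sigma>") (auto simp: states_def peeled_def)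

lemma attach_in_states:
  assumes "\<rho> \<in> peeled i"
  shows "attach i \<rho> \<in> states"
proof -
  obtain a w where \<rho>: "\<rho> = (a, w)" by (cases \<rho>)
  with assms have "a \<in> carrier (F i)" by (simp add: peeled_def)
  then obtain n s where "n \<in> carrier N" "s \<in> S i" "a = e i n \<otimes>\<^bsub>F i\<^esub> s" by (rule decompE)
  then show ?thesis using assms \<rho> side_S[of s i] by (simp add: states_def peeled_def)
qed

lemma attach_peel: "\<sigma> \<in> states \<Longrightarrow> attach i (peel i \<sigma>) = \<sigma>"
  by (cases \<sigma>; cases "snd \<sigma>") (auto simp: states_def)

lemma peel_attach:
  assumes "\<rho> \<in> peeled i"
  shows "peel i (attach i \<rho>) = \<rho>"
proof -
  obtain a w where \<rho>: "\<rho> = (a, w)" by (cases \<rho>)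
  with assms have "a \<in> carrier (F i)" by (simp add: peeled_def)
  then obtain n s where "n \<in> carrier N" "s \<in> S i" "a = e i n \<otimes>\<^bsub>F i\<^esub> s" by (rule decompE)
  then show ?thesis using assms \<rho> side_S[of s i] by (simp add: peeled_def)
qed

declare peel.simps [simp del] attach.simps [simp del]

lemma peel_act:
  assumes "x \<in> carrier (F i)" "\<sigma> \<in> states" "peel i \<sigma> = (a, w)"
  shows "peel i (act x \<sigma>) = (x \<otimes>\<^bsub>F i\<^esub> a, w)" "act x \<sigma> = attach i (x \<otimes>\<^bsub>F i\<^esub> a, w)"
    "act x \<sigma> \<in> states"
proof -
  have "(a, w) \<in> peeled i" using peel_in_peeled[OF assms(2), of i] assms(3) by simp
  then have *: "(x \<otimes>\<^bsub>F i\<^esub> a, w) \<in> peeled i" using assms(1) by (simp add: peeled_def)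
  show **: "act x \<sigma> = attach i (x \<otimes>\<^bsub>F i\<^esub> a, w)"
    using assms side[OF assms(1)] by (simp add: act_def)
  show "peel i (act x \<sigma>) = (x \<otimes>\<^bsub>F i\<^esub> a, w)" using * ** by (simp add: peel_attach)
  show "act x \<sigma> \<in> states" using * ** by (simp add: attach_in_states)
qed

lemma peel_inj: "\<sigma> \<in> states \<Longrightarrow> \<tau> \<in> states \<Longrightarrow> peel i \<sigma> = peel i \<tau> \<Longrightarrow> \<sigma> = \<tau>"
  by (metis attach_peel)

lemma act_in_states [simp]: "x \<in> carrier (F i) \<Longrightarrow> \<sigma> \<in> states \<Longrightarrow> act x \<sigma> \<in> states"
  by (cases "peel i \<sigma>") (rule peel_act(3))

lemma act_mult:
  assumes "x \<in> carrier (F i)" "y \<in> carrier (F i)" "\<sigma> \<in> states"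
  shows "act (x \<otimes>\<^bsub>F i\<^esub> y) \<sigma> = act x (act y \<sigma>)"
proof -
  obtain a w where p: "peel i \<sigma> = (a, w)" by (cases "peel i \<sigma>")
  then have "a \<in> carrier (F i)" using peel_in_peeled[OF assms(3), of i] by (simp add: peeled_def)
  then show ?thesis
    using assms p peel_act[OF _ assms(3) p] peel_act(2)[of x i "act y \<sigma>"] by (simp add: F.m_assoc)
qed

lemma act_one:
  assumes "\<sigma> \<in> states"
  shows "act \<one>\<^bsub>F i\<^esub> \<sigma> = \<sigma>"
proof -
  obtain a w where p: "peel i \<sigma> = (a, w)" by (cases "peel i \<sigma>")
  then have "a \<in> carrier (F i)" using peel_in_peeled[OF assms, of i] by (simp add: peeled_def)
  then have "act \<one>\<^bsub>F i\<^esub> \<sigma> = attach i (a, w)"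
    using peel_act(2)[OF F.one_closed assms p] by simp
  also have "\<dots> = \<sigma>" using attach_peel[OF assms, of i] p by simp
  finally show ?thesis .
qed

text \<open>The result does not mention \<open>i\<close>: the actions of the factors agree on \<open>N\<close>, and therefore assemble
to an action of the amalgam.\<close>

lemma act_e:
  assumes "n \<in> carrier N" "(m, w) \<in> states"
  shows "act (e i n) (m, w) = (n \<otimes>\<^bsub>N\<^esub> m, w)"
proof (rule peel_inj)
  have m: "m \<in> carrier N" and w: "reduced w" using assms(2) by (simp_all add: states_def)
  show "(n \<otimes>\<^bsub>N\<^esub> m, w) \<in> states" using m w assms(1) by (simp add: states_def)
  show "act (e i n) (m, w) \<in> states" using assms by (simp add: act_in_states[of _ i])
  have "hd w \<in> carrier (F i)" if "starts i w" using that w by (cases w) auto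
  then show "peel i (act (e i n) (m, w)) = peel i (n \<otimes>\<^bsub>N\<^esub> m, w)"
    using assms m peel_act(1)[of "e i n" i "(m, w)"] by (simp add: peel.simps e_mult F.m_assoc)
qed


definition letters :: "'l set"
  where "letters = (\<Union>i. carrier (F i))"

lemma letters_closed [simp]: "x \<in> carrier (F i) \<Longrightarrow> x \<in> letters"
  by (auto simp: letters_def)

lemma lettersE:
  assumes "x \<in> letters"
  obtains i where "x \<in> carrier (F i)" "side x = i"
  using assms side by (auto simp: letters_def)

lemma act_letter_in_states: "x \<in> letters \<Longrightarrow> \<sigma> \<in> states \<Longrightarrow> act x \<sigma> \<in> states"
  by (erule lettersE) (rule act_in_states)

lemma run_Nil [simp]: "run [] \<sigma> = \<sigma>"
  and run_Cons [simp]: "run (x # w) \<sigma> = act x (run w \<sigma>)"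
  and run_append: "run (u @ v) \<sigma> = run u (run v \<sigma>)"
  by (simp_all add: run_def)

lemma run_in_states: "w \<in> lists letters \<Longrightarrow> \<sigma> \<in> states \<Longrightarrow> run w \<sigma> \<in> states"
  by (induction w) (auto simp: act_letter_in_states)

lemma initial_state [simp]: "(\<one>\<^bsub>N\<^esub>, []) \<in> states"
  by (simp add: states_def)

lemma nf_in_states: "w \<in> lists letters \<Longrightarrow> nf w \<in> states"
  by (simp add: nf_def run_in_states)

lemma nf_reduced: "reduced w \<Longrightarrow> nf w = (\<one>\<^bsub>N\<^esub>, w)"
proof (induction w)
  case Nil
  then show ?case by (simp add: nf_def)
next
  case (Cons s w)
  define i where "i = side s"
  have s: "s \<in> S i" "s \<noteq> \<one>\<^bsub>F i\<^esub>" "\<not> starts i w" "reduced w"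
    using Cons.prems by (simp_all add: i_def)
  have st: "(\<one>\<^bsub>N\<^esub>, w) \<in> states" using s by (simp add: states_def)
  have "nf (s # w) = act s (\<one>\<^bsub>N\<^esub>, w)" using Cons.IH s(4) by (simp add: nf_def)
  also have "\<dots> = attach i (s, w)"
    using peel_act(2)[of s i "(\<one>\<^bsub>N\<^esub>, w)" "\<one>\<^bsub>F i\<^esub>" w] s st by (simp add: peel.simps)
  also have "\<dots> = (\<one>\<^bsub>N\<^esub>, s # w)"
    using decomp_mult[of "\<one>\<^bsub>N\<^esub>" s i] s by (simp add: attach.simps)
  finally show ?case .
qed

lemma nf_state: "(n, w) \<in> states \<Longrightarrow> nf (e i n # w) = (n, w)"
  using nf_reduced[of w] act_e[of n "\<one>\<^bsub>N\<^esub>" w i] by (simp add: nf_def states_def)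

context
  \<comment> \<open>A map \<open>\<phi>\<close> into a monoid that respects the relations of the amalgam among the letters of \<open>P\<close>.
    As \<open>P\<close> is closed under factors, the letters arising from a word over \<open>P\<close> during normalization
    stay in \<open>P\<close>.\<close>
  fixes K :: "('d, 'k) monoid_scheme" and P :: "'l set" and \<phi> :: "'l \<Rightarrow> 'd"
  assumes K: "monoid K"
    and P_sub: "P \<subseteq> letters" and P_one: "\<And>i. \<one>\<^bsub>F i\<^esub> \<in> P"
    and P_mult: "\<And>i x y. x \<in> carrier (F i) \<Longrightarrow> y \<in> carrier (F i) \<Longrightarrow>
      x \<otimes>\<^bsub>F i\<^esub> y \<in> P \<longleftrightarrow> x \<in> P \<and> y \<in> P"
    and P_e: "\<And>i j n. n \<in> carrier N \<Longrightarrow> e i n \<in> P \<Longrightarrow> e j n \<in> P"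
    and \<phi>_closed: "\<And>x. x \<in> P \<Longrightarrow> \<phi> x \<in> carrier K"
    and \<phi>_one: "\<And>i. \<phi> \<one>\<^bsub>F i\<^esub> = \<one>\<^bsub>K\<^esub>"
    and \<phi>_mult: "\<And>i x y. x \<in> carrier (F i) \<Longrightarrow> y \<in> carrier (F i) \<Longrightarrow> x \<in> P \<Longrightarrow> y \<in> P \<Longrightarrow>
      \<phi> (x \<otimes>\<^bsub>F i\<^esub> y) = \<phi> x \<otimes>\<^bsub>K\<^esub> \<phi> y"
    and \<phi>_e: "\<And>i j n. n \<in> carrier N \<Longrightarrow> e i n \<in> P \<Longrightarrow> \<phi> (e i n) = \<phi> (e j n)"
begin

interpretation K: monoid K by (rule K)

abbreviation eval :: "'l list \<Rightarrow> 'd"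
  where "eval w \<equiv> foldr (\<lambda>x k. \<phi> x \<otimes>\<^bsub>K\<^esub> k) w \<one>\<^bsub>K\<^esub>"

lemma eval_closed: "w \<in> lists P \<Longrightarrow> eval w \<in> carrier K"
  by (induction w) (auto simp: \<phi>_closed)

lemma eval_peel:
  assumes "(n, w) \<in> states" "e i n \<in> P" "w \<in> lists P" "peel i (n, w) = (a, w')"
  shows "a \<in> P" "w' \<in> lists P" "\<phi> (e i n) \<otimes>\<^bsub>K\<^esub> eval w = \<phi> a \<otimes>\<^bsub>K\<^esub> eval w'"
proof -
  have n: "n \<in> carrier N" using assms(1) by (simp add: states_def)
  have "a \<in> P \<and> w' \<in> lists P \<and> \<phi> (e i n) \<otimes>\<^bsub>K\<^esub> eval w = \<phi> a \<otimes>\<^bsub>K\<^esub> eval w'"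
  proof (cases "starts i w")
    case True
    then obtain s where w: "w = s # w'" "side s = i" and a: "a = e i n \<otimes>\<^bsub>F i\<^esub> s"
      using assms(4) by (cases w) (auto simp: peel.simps)
    then have "s \<in> S i" using assms(1) by (simp add: states_def)
    then have s: "s \<in> carrier (F i)" by simp
    moreover have "s \<in> P" "w' \<in> lists P" using w assms(3) by simp_all
    ultimately show ?thesis
      using assms(2) n a w P_mult[of "e i n" i s] \<phi>_mult[of "e i n" i s] eval_closed[of w']
      by (simp add: K.m_assoc \<phi>_closed)
  next
    case False
    then show ?thesis using assms by (simp add: peel.simps)
  qed
  then show "a \<in> P" "w' \<in> lists P" "\<phi> (e i n) \<otimes>\<^bsub>K\<^esub> eval w = \<phi> a \<otimes>\<^bsub>K\<^esub> eval w'" by blast+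
qed

lemma eval_attach:
  assumes "a \<in> carrier (F i)" "a \<in> P" "w \<in> lists P" "attach i (a, w) = (n, w')"
  shows "e i n \<in> P" "w' \<in> lists P" "\<phi> (e i n) \<otimes>\<^bsub>K\<^esub> eval w' = \<phi> a \<otimes>\<^bsub>K\<^esub> eval w"
proof -
  obtain m s where ms: "m \<in> carrier N" "s \<in> S i" "a = e i m \<otimes>\<^bsub>F i\<^esub> s"
    using assms(1) by (rule decompE)
  have nw: "n = m" "w' = (if s = \<one>\<^bsub>F i\<^esub> then w else s # w)"
    using assms(4) ms by (simp_all add: attach.simps)
  have P: "e i m \<in> P" "s \<in> P" using P_mult[of "e i m" i s] ms assms(2) by simp_all
  have "\<phi> a = \<phi> (e i m) \<otimes>\<^bsub>K\<^esub> \<phi> s" using \<phi>_mult[of "e i m" i s] ms P by simp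
  then show "e i n \<in> P" "w' \<in> lists P" "\<phi> (e i n) \<otimes>\<^bsub>K\<^esub> eval w' = \<phi> a \<otimes>\<^bsub>K\<^esub> eval w"
    using P nw assms(3) eval_closed[OF assms(3)] by (simp_all add: K.m_assoc \<phi>_closed \<phi>_one)
qed

lemma eval_nf:
  assumes "u \<in> lists P" "nf u = (n, w)"
  shows "e i n \<in> P \<and> w \<in> lists P \<and> eval u = \<phi> (e i n) \<otimes>\<^bsub>K\<^esub> eval w"
  using assms
proof (induction u arbitrary: n w i)
  case Nil
  then show ?case by (auto simp: nf_def P_one \<phi>_one)
next
  case (Cons x u)
  then have x: "x \<in> P" and u: "u \<in> lists P" by simp_all
  obtain j where j: "x \<in> carrier (F j)" using x P_sub by (blast elim: lettersE)
  obtain m v where mv: "nf u = (m, v)" by (cases "nf u")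
  have st: "(m, v) \<in> states" using nf_in_states[of u] u P_sub mv by (auto simp: lists_mono subsetD)
  obtain a v' where av: "peel j (m, v) = (a, v')" by (cases "peel j (m, v)")
  have a: "a \<in> carrier (F j)" using peel_in_peeled[OF st, of j] av by (simp add: peeled_def)
  have IH: "e j m \<in> P" "v \<in> lists P" "eval u = \<phi> (e j m) \<otimes>\<^bsub>K\<^esub> eval v"
    using Cons.IH[OF mv, of j] by simp_all
  note p = eval_peel[OF st IH(1,2) av]
  have xa: "x \<otimes>\<^bsub>F j\<^esub> a \<in> P" "x \<otimes>\<^bsub>F j\<^esub> a \<in> carrier (F j)"
    using P_mult[OF j a] x p(1) j a by simp_all
  have "attach j (x \<otimes>\<^bsub>F j\<^esub> a, v') = (n, w)"
    using peel_act(2)[OF j st av] Cons.prems mv by (simp add: nf_def)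
  note q = eval_attach[OF xa(2,1) p(2) this]
  have "(n, w) \<in> states"
    using nf_in_states[of "x # u"] Cons.prems x u P_sub by (auto simp: lists_mono subsetD)
  then have n: "n \<in> carrier N" by (simp add: states_def)
  have "eval (x # u) = \<phi> x \<otimes>\<^bsub>K\<^esub> (\<phi> a \<otimes>\<^bsub>K\<^esub> eval v')" using IH(3) p(3) by simp
  also have "\<dots> = \<phi> (e j n) \<otimes>\<^bsub>K\<^esub> eval w"
    using q(3) \<phi>_mult[OF j a x p(1)] x p eval_closed[OF p(2)] by (simp add: K.m_assoc \<phi>_closed)
  finally show ?case using q P_e[OF n q(1), of i] \<phi>_e[OF n q(1), of i] by simp
qed

text \<open>Completeness of normal forms, for every factor-closed set of letters at once. Applied to the amalgam of
submonoids it yields the injectivity of the canonical map.\<close>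

lemma nf_determines_eval:
  assumes "u \<in> lists P" "v \<in> lists P" "nf u = nf v"
  shows "eval u = eval v"
proof -
  obtain n w where "nf u = (n, w)" by (cases "nf u")
  then show ?thesis
    using eval_nf[OF assms(1), of n w undefined] eval_nf[OF assms(2), of n w undefined] assms(3) by simp
qed

end

text \<open>Freeness of the action of \<open>F i\<close> turns division of a normal form by a letter of \<open>F i\<close> into division
of its first component inside \<open>F i\<close>.\<close>

lemma act_solvable_iff:
  assumes "x \<in> carrier (F i)" "\<sigma> \<in> states"
  shows "(\<exists>\<tau> \<in> states. act x \<tau> = \<sigma>) \<longleftrightarrow> le_L (F i) x (fst (peel i \<sigma>))"
proof
  assume "\<exists>\<tau> \<in> states. act x \<tau> = \<sigma>"
  then obtain \<tau> where \<tau>: "\<tau> \<in> states" "act x \<tau> = \<sigma>" by blast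
  obtain a w where p: "peel i \<tau> = (a, w)" by (cases "peel i \<tau>")
  then have "a \<in> carrier (F i)" using peel_in_peeled[OF \<tau>(1), of i] by (simp add: peeled_def)
  then show "le_L (F i) x (fst (peel i \<sigma>))"
    using peel_act(1)[OF assms(1) \<tau>(1) p] \<tau>(2) by (auto simp: le_L_def)
next
  assume "le_L (F i) x (fst (peel i \<sigma>))"
  then obtain b where b: "b \<in> carrier (F i)" "fst (peel i \<sigma>) = x \<otimes>\<^bsub>F i\<^esub> b"
    by (auto simp: le_L_def)
  obtain w where w: "peel i \<sigma> = (x \<otimes>\<^bsub>F i\<^esub> b, w)" using b by (metis prod.collapse)
  then have bw: "(b, w) \<in> peeled i"
    using peel_in_peeled[OF assms(2), of i] b by (simp add: peeled_def)
  let ?\<tau> = "attach i (b, w)"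
  have "act x ?\<tau> = \<sigma>"
    using peel_act(2)[OF assms(1) attach_in_states[OF bw] peel_attach[OF bw]] w
      attach_peel[OF assms(2), of i] by simp
  then show "\<exists>\<tau> \<in> states. act x \<tau> = \<sigma>" using attach_in_states[OF bw] by blast
qed

lemma act_l_cancel:
  assumes "x \<in> carrier (F i)" "\<sigma> \<in> states" "\<tau> \<in> states" "act x \<sigma> = act x \<tau>"
    and cancel: "\<And>a b. a \<in> carrier (F i) \<Longrightarrow> b \<in> carrier (F i) \<Longrightarrow>
      x \<otimes>\<^bsub>F i\<^esub> a = x \<otimes>\<^bsub>F i\<^esub> b \<Longrightarrow> a = b"
  shows "\<sigma> = \<tau>"
proof (rule peel_inj[OF assms(2,3)])
  obtain a w b v where p: "peel i \<sigma> = (a, w)" "peel i \<tau> = (b, v)"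
    by (cases "peel i \<sigma>"; cases "peel i \<tau>")
  then have "a \<in> carrier (F i)" "b \<in> carrier (F i)"
    using peel_in_peeled[OF assms(2), of i] peel_in_peeled[OF assms(3), of i]
    by (simp_all add: peeled_def)
  moreover have "x \<otimes>\<^bsub>F i\<^esub> a = x \<otimes>\<^bsub>F i\<^esub> b \<and> w = v"
    using peel_act(1)[OF assms(1,2) p(1)] peel_act(1)[OF assms(1,3) p(2)] assms(4) by simp
  ultimately show "peel i \<sigma> = peel i \<tau>" using p cancel[of a b] by simp
qed

text \<open>A normal form cannot start in two different factors.\<close>

lemma peel_in_base:
  assumes "\<sigma> \<in> states" "i \<noteq> j"
  shows "fst (peel i \<sigma>) \<in> e i ` carrier N \<or> fst (peel j \<sigma>) \<in> e j ` carrier N"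
  using assms by (cases \<sigma>) (auto simp: peel.simps starts_def states_def)

text \<open>For the empty word, \<open>side (hd [])\<close> is an unspecified but fixed index, and \<open>peel\<close> returns the image of
\<open>n\<close> in that factor; any fixed choice would do.\<close>

fun complexity :: "('i \<Rightarrow> 'l \<Rightarrow> nat) \<Rightarrow> 'c \<times> 'l list \<Rightarrow> nat \<times> nat"
  where "complexity \<nu> (n, w) = (let i = side (hd w) in (length w, \<nu> i (fst (peel i (n, w)))))"

text \<open>A letter from \<open>N\<close> keeps the reduced word and enlarges the first syllable. Any other letter of \<open>F i\<close>
leads to a normal form starting in \<open>F i\<close>; either a new syllable was created, or the first one grew.\<close>

lemma complexity_act:
  assumes \<nu>_pos: "\<And>i a. a \<in> carrier (F i) \<Longrightarrow> a \<noteq> \<one>\<^bsub>F i\<^esub> \<Longrightarrow> \<nu> i a > 0"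
    and \<nu>_mult: "\<And>i a b. a \<in> carrier (F i) \<Longrightarrow> b \<in> carrier (F i) \<Longrightarrow> \<nu> i (a \<otimes>\<^bsub>F i\<^esub> b) \<ge> \<nu> i a + \<nu> i b"
    and factor: "\<And>i a b. a \<in> carrier (F i) \<Longrightarrow> b \<in> carrier (F i) \<Longrightarrow>
      a \<otimes>\<^bsub>F i\<^esub> b \<in> e i ` carrier N \<Longrightarrow> a \<in> e i ` carrier N"
    and x: "x \<in> carrier (F i)" "x \<noteq> \<one>\<^bsub>F i\<^esub>" and \<tau>: "\<tau> \<in> states"
  shows "(complexity \<nu> \<tau>, complexity \<nu> (act x \<tau>)) \<in> less_than <*lex*> less_than"
proof -
  have drop: "\<nu> j a < \<nu> j (y \<otimes>\<^bsub>F j\<^esub> a)"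
    if "y \<in> carrier (F j)" "y \<noteq> \<one>\<^bsub>F j\<^esub>" "a \<in> carrier (F j)" for j y a
    using \<nu>_pos[OF that(1,2)] \<nu>_mult[OF that(1,3)] by simp
  obtain n w where nw: "\<tau> = (n, w)" by (cases \<tau>)
  show ?thesis
  proof (cases "x \<in> e i ` carrier N")
    case True
    then obtain m where m: "m \<in> carrier N" "x = e i m" by blast
    define j where "j = side (hd w)"
    have "act x \<tau> = (m \<otimes>\<^bsub>N\<^esub> n, w)" "act (e j m) \<tau> = (m \<otimes>\<^bsub>N\<^esub> n, w)"
      using act_e m \<tau> nw by simp_all
    moreover obtain a v where p: "peel j \<tau> = (a, v)" by (cases "peel j \<tau>")
    moreover have "peel j (act (e j m) \<tau>) = (e j m \<otimes>\<^bsub>F j\<^esub> a, v)"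
      using peel_act(1)[OF _ \<tau> p] m by simp
    moreover have "e j m \<noteq> \<one>\<^bsub>F j\<^esub>"
    proof
      assume "e j m = \<one>\<^bsub>F j\<^esub>"
      then have "decomp j (e j m) = decomp j (e j \<one>\<^bsub>N\<^esub>)" by simp
      then have "m = \<one>\<^bsub>N\<^esub>" using m by (simp del: e_one)
      then show False using m x by simp
    qed
    moreover have "a \<in> carrier (F j)" using peel_in_peeled[OF \<tau>, of j] p by (simp add: peeled_def)
    ultimately show ?thesis using drop[of "e j m" j a] m nw by (simp add: j_def[symmetric])
  next
    case False
    obtain a v where p: "peel i \<tau> = (a, v)" by (cases "peel i \<tau>")
    have a: "a \<in> carrier (F i)" using peel_in_peeled[OF \<tau>, of i] p by (simp add: peeled_def)
    obtain n' w' where nw': "act x \<tau> = (n', w')" by (cases "act x \<tau>")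
    have n': "n' \<in> carrier N" using act_in_states[OF x(1) \<tau>] nw' by (simp add: states_def)
    have p': "peel i (n', w') = (x \<otimes>\<^bsub>F i\<^esub> a, v)" using peel_act(1)[OF x(1) \<tau> p] nw' by simp
    have "starts i w'"
    proof (rule ccontr)
      assume "\<not> starts i w'"
      then have "x \<otimes>\<^bsub>F i\<^esub> a \<in> e i ` carrier N" using p' n' by (simp add: peel.simps) (metis imageI)
      then show False using factor[OF x(1) a] False by simp
    qed
    then obtain s where s: "w' = s # v" "side s = i"
      using p' by (cases w') (auto simp: peel.simps)
    show ?thesis
    proof (cases "starts i w")
      case True
      then obtain t where "w = t # v" "side t = i"
        using p nw by (cases w) (auto simp: peel.simps)
      then show ?thesis using s p p' nw nw' drop[OF x a] by simp
    next
      case False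
      then have "w = v" using p nw by (simp add: peel.simps)
      then show ?thesis using s nw nw' by (simp add: Let_def)
    qed
  qed
qed

end

section \<open>Common multiples and retractions\<close>

lemma le_LI: "c \<in> carrier M \<Longrightarrow> le_L M a (a \<otimes>\<^bsub>M\<^esub> c)"
  by (auto simp: le_L_def)

lemma le_L_trans:
  assumes "monoid G" "a \<in> carrier G" "le_L G a b" "le_L G b c"
  shows "le_L G a c"
  using assms by (auto simp: le_L_def monoid.m_assoc intro!: monoid.m_closed bexI)

text \<open>Local-to-global principle in the style of Garside: if any two elements of a generating set \<open>X\<close> of \<open>Q\<close>
that divide \<open>d\<close> have a common multiple in \<open>Q\<close> dividing \<open>d\<close>, then so do any two elements of \<open>Q\<close>.
The induction is on \<open>d\<close>: split off generators \<open>x\<close> of \<open>a\<close> and \<open>y\<close> of \<open>b\<close>, take a common multiple \<open>z\<close>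
of \<open>x\<close> and \<open>y\<close>, complete \<open>a\<close> and \<open>z\<close> as well as \<open>b\<close> and \<open>z\<close>, and finally complete the two
resulting multiples \<open>z u\<close> and \<open>z v\<close>. After cancelling \<open>x\<close>, \<open>y\<close> and \<open>z\<close>, respectively, each completion
takes place below a proper right divisor of \<open>d\<close>.\<close>

lemma directed_divisors:
  assumes G: "monoid G"
    and cancel: "\<And>x b c. x \<in> carrier G \<Longrightarrow> b \<in> carrier G \<Longrightarrow> c \<in> carrier G \<Longrightarrow>
      x \<otimes>\<^bsub>G\<^esub> b = x \<otimes>\<^bsub>G\<^esub> c \<Longrightarrow> b = c"
    and wf: "wf {(d', d). d' \<in> carrier G \<and> (\<exists>z \<in> carrier G - {\<one>\<^bsub>G\<^esub>}. d = z \<otimes>\<^bsub>G\<^esub> d')}"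
    and Q_sub: "Q \<subseteq> carrier G"
    and Q_mult: "\<And>a b. a \<in> carrier G \<Longrightarrow> b \<in> carrier G \<Longrightarrow> a \<otimes>\<^bsub>G\<^esub> b \<in> Q \<longleftrightarrow> a \<in> Q \<and> b \<in> Q"
    and X_gen: "\<And>a. a \<in> Q \<Longrightarrow> a \<noteq> \<one>\<^bsub>G\<^esub> \<Longrightarrow> \<exists>x \<in> X - {\<one>\<^bsub>G\<^esub>}. le_L G x a"
    and X_sub: "X \<subseteq> carrier G"
    and X: "\<And>x y d. x \<in> X \<Longrightarrow> y \<in> X \<Longrightarrow> d \<in> carrier G \<Longrightarrow> le_L G x d \<Longrightarrow> le_L G y d \<Longrightarrow>
      \<exists>z \<in> Q. le_L G x z \<and> le_L G y z \<and> le_L G z d"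
    and "d \<in> carrier G" "a \<in> Q" "b \<in> Q" "le_L G a d" "le_L G b d"
  shows "\<exists>c \<in> Q. le_L G a c \<and> le_L G b c \<and> le_L G c d"
  using wf assms(9-13)
proof (induction d arbitrary: a b rule: wf_induct_rule)
  case (less d)
  interpret monoid G by (rule G)
  note below = less.prems(1,4,5)
  have ab: "a \<in> carrier G" "b \<in> carrier G" using less.prems Q_sub by blast+
  have refl: "le_L G c c" if "c \<in> carrier G" for c
    using that by (auto simp: le_L_def intro: bexI[of _ "\<one>\<^bsub>G\<^esub>"])
  have IH: "\<exists>c \<in> Q. le_L G a' c \<and> le_L G b' c \<and> le_L G c d'"
    if "d = z \<otimes>\<^bsub>G\<^esub> d'" "z \<in> carrier G" "z \<noteq> \<one>\<^bsub>G\<^esub>" "d' \<in> carrier G"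
      "a' \<in> Q" "b' \<in> Q" "le_L G a' d'" "le_L G b' d'" for z d' a' b'
    using less.IH[of d' a' b'] that by blast
  \<comment> \<open>The completion of \<open>a = x a'\<close> and \<open>z = x x'\<close>, obtained from one of \<open>a'\<close> and \<open>x'\<close>.\<close>
  have extend: "\<exists>u \<in> carrier G. \<exists>c. c = z \<otimes>\<^bsub>G\<^esub> u \<and> c \<in> Q \<and> le_L G a c \<and> le_L G c d"
    if a: "a \<in> Q" "le_L G a d" "a = x \<otimes>\<^bsub>G\<^esub> a'" "a' \<in> carrier G"
      and x: "x \<in> carrier G" "x \<noteq> \<one>\<^bsub>G\<^esub>"
      and z: "z \<in> Q" "z = x \<otimes>\<^bsub>G\<^esub> x'" "x' \<in> carrier G" "le_L G z d" for a x a' z x'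
  proof -
    obtain r s where r: "r \<in> carrier G" "d = a \<otimes>\<^bsub>G\<^esub> r" and s: "s \<in> carrier G" "d = z \<otimes>\<^bsub>G\<^esub> s"
      using a(2) z(4) by (auto simp: le_L_def)
    let ?d = "a' \<otimes>\<^bsub>G\<^esub> r"
    have d: "d = x \<otimes>\<^bsub>G\<^esub> ?d" using r a x by (simp add: m_assoc)
    also have "d = x \<otimes>\<^bsub>G\<^esub> (x' \<otimes>\<^bsub>G\<^esub> s)" using s z x by (simp add: m_assoc)
    finally have eq: "?d = x' \<otimes>\<^bsub>G\<^esub> s"
      using cancel[of x "x' \<otimes>\<^bsub>G\<^esub> s" ?d] x z s r a by simp
    have "a' \<in> Q" "x' \<in> Q" "x \<in> Q" using Q_mult[of x a'] Q_mult[of x x'] a x z by simp_all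
    moreover have "le_L G a' ?d" "le_L G x' ?d" using le_LI[OF r(1)] le_LI[OF s(1)] eq by metis+
    ultimately obtain c where c: "c \<in> Q" "le_L G a' c" "le_L G x' c" "le_L G c ?d"
      using IH[OF d x] r a by blast
    then have cG: "c \<in> carrier G" using Q_sub by blast
    obtain k u t where k: "k \<in> carrier G" "c = a' \<otimes>\<^bsub>G\<^esub> k" and u: "u \<in> carrier G" "c = x' \<otimes>\<^bsub>G\<^esub> u"
      and t: "t \<in> carrier G" "?d = c \<otimes>\<^bsub>G\<^esub> t" using c by (auto simp: le_L_def)
    have "x \<otimes>\<^bsub>G\<^esub> c = z \<otimes>\<^bsub>G\<^esub> u" using u x z by (simp add: m_assoc)
    moreover have "x \<otimes>\<^bsub>G\<^esub> c = a \<otimes>\<^bsub>G\<^esub> k" using k x a by (simp add: m_assoc)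
    moreover have "d = x \<otimes>\<^bsub>G\<^esub> c \<otimes>\<^bsub>G\<^esub> t" using d t x cG by (simp add: m_assoc)
    moreover have "x \<otimes>\<^bsub>G\<^esub> c \<in> Q" using Q_mult[of x c] x cG c \<open>x \<in> Q\<close> by simp
    ultimately show ?thesis using u k t unfolding le_L_def by metis
  qed
  show ?case
  proof (cases "a = \<one>\<^bsub>G\<^esub> \<or> b = \<one>\<^bsub>G\<^esub>")
    case True
    then have "le_L G a b \<or> le_L G b a" using ab by (auto simp: le_L_def)
    then show ?thesis using refl ab less.prems by blast
  next
    case False
    then obtain x y where xX: "x \<in> X" "x \<noteq> \<one>\<^bsub>G\<^esub>" "le_L G x a" and yX: "y \<in> X" "y \<noteq> \<one>\<^bsub>G\<^esub>" "le_L G y b"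
      using X_gen less.prems by blast
    then have x: "x \<in> carrier G" and y: "y \<in> carrier G" using X_sub by blast+
    obtain a' b' where a': "a' \<in> carrier G" "a = x \<otimes>\<^bsub>G\<^esub> a'" and b': "b' \<in> carrier G" "b = y \<otimes>\<^bsub>G\<^esub> b'"
      using xX yX by (auto simp: le_L_def)
    have "le_L G x d" "le_L G y d"
      using le_L_trans[OF G x xX(3) less.prems(4)] le_L_trans[OF G y yX(3) less.prems(5)] by simp_all
    then obtain z where z: "z \<in> Q" "le_L G x z" "le_L G y z" "le_L G z d"
      using X[OF xX(1) yX(1) less.prems(1)] by blast
    then have zG: "z \<in> carrier G" using Q_sub by blast
    obtain x' y' where x': "x' \<in> carrier G" "z = x \<otimes>\<^bsub>G\<^esub> x'" and y': "y' \<in> carrier G" "z = y \<otimes>\<^bsub>G\<^esub> y'"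
      using z by (auto simp: le_L_def)
    obtain u where u: "u \<in> carrier G" "z \<otimes>\<^bsub>G\<^esub> u \<in> Q" "le_L G a (z \<otimes>\<^bsub>G\<^esub> u)" "le_L G (z \<otimes>\<^bsub>G\<^esub> u) d"
      using extend[OF less.prems(2,4) a'(2,1) x xX(2) z(1) x'(2,1) z(4)] by blast
    obtain v where v: "v \<in> carrier G" "z \<otimes>\<^bsub>G\<^esub> v \<in> Q" "le_L G b (z \<otimes>\<^bsub>G\<^esub> v)" "le_L G (z \<otimes>\<^bsub>G\<^esub> v) d"
      using extend[OF less.prems(3,5) b'(2,1) y yX(2) z(1) y'(2,1) z(4)] by blast
    show ?thesis
    proof (cases "z = \<one>\<^bsub>G\<^esub>")
      case True
      then have "x \<otimes>\<^bsub>G\<^esub> x' = \<one>\<^bsub>G\<^esub>" using x' by simp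
      \<comment> \<open>Then \<open>x\<close> is a nontrivial unit, which contradicts well-foundedness.\<close>
      then have "d = x \<otimes>\<^bsub>G\<^esub> (x' \<otimes>\<^bsub>G\<^esub> d)" using x x' less.prems(1) by (metis l_one m_assoc)
      moreover have "x' \<noteq> \<one>\<^bsub>G\<^esub>" using \<open>x \<otimes>\<^bsub>G\<^esub> x' = \<one>\<^bsub>G\<^esub>\<close> x xX(2) by auto
      ultimately have False using wf_not_sym[OF wf, of "x' \<otimes>\<^bsub>G\<^esub> d" d] x x' xX(2) less.prems(1) by auto
      then show ?thesis ..
    next
      case False
      obtain e where e: "e \<in> carrier G" "d = z \<otimes>\<^bsub>G\<^esub> e" using z(4) by (auto simp: le_L_def)
      have cancel_z: "le_L G w e" if "w \<in> carrier G" "le_L G (z \<otimes>\<^bsub>G\<^esub> w) d" for w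
      proof -
        from that obtain t where t: "t \<in> carrier G" "d = z \<otimes>\<^bsub>G\<^esub> w \<otimes>\<^bsub>G\<^esub> t" by (auto simp: le_L_def)
        then have "e = w \<otimes>\<^bsub>G\<^esub> t" using cancel[OF zG, of e "w \<otimes>\<^bsub>G\<^esub> t"] e that zG by (simp add: m_assoc)
        then show ?thesis using t by (auto simp: le_L_def)
      qed
      have "u \<in> Q" "v \<in> Q" using Q_mult zG u v by simp_all
      then obtain w where w: "w \<in> Q" "le_L G u w" "le_L G v w" "le_L G w e"
        using IH[OF e(2) zG False e(1)] cancel_z u v by blast
      then have wG: "w \<in> carrier G" using Q_sub by blast
      have shift: "le_L G (z \<otimes>\<^bsub>G\<^esub> s) (z \<otimes>\<^bsub>G\<^esub> t)" if "le_L G s t" "s \<in> carrier G" for s t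
        using that zG by (auto simp: le_L_def m_assoc)
      have "le_L G a (z \<otimes>\<^bsub>G\<^esub> w)" "le_L G b (z \<otimes>\<^bsub>G\<^esub> w)" "le_L G (z \<otimes>\<^bsub>G\<^esub> w) d"
        using le_L_trans[OF G ab(1) u(3) shift[OF w(2) u(1)]]
          le_L_trans[OF G ab(2) v(3) shift[OF w(3) v(1)]] shift[OF w(4) wG] e by simp_all
      then show ?thesis using Q_mult[OF zG wG] z(1) w(1) by blast
    qed
  qed
qed

text \<open>Joins are preserved by a monotone map along which every lower set of the form \<open>{x. r' (h x) d}\<close> is
principal.\<close>

lemma is_join_image:
  assumes "is_join r S a b c" "h ` S \<subseteq> S'" "a \<in> S" "b \<in> S"
    and mono: "\<And>x y. x \<in> S \<Longrightarrow> y \<in> S \<Longrightarrow> r x y \<Longrightarrow> r' (h x) (h y)"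
    and retract: "\<And>d. d \<in> S' \<Longrightarrow> \<exists>p \<in> S. \<forall>x \<in> S. r' (h x) d \<longleftrightarrow> r x p"
  shows "is_join r' S' (h a) (h b) (h c)"
proof -
  have c: "c \<in> S" "r a c" "r b c" "\<And>d. d \<in> S \<Longrightarrow> r a d \<Longrightarrow> r b d \<Longrightarrow> r c d"
    using assms(1) by (simp_all add: is_join_def)
  have "r' (h c) d" if d: "d \<in> S'" "r' (h a) d" "r' (h b) d" for d
  proof -
    obtain p where "p \<in> S" "\<forall>x \<in> S. r' (h x) d \<longleftrightarrow> r x p" using retract[OF d(1)] by blast
    then show ?thesis using d(2,3) assms(3,4) c by blast
  qed
  then show ?thesis using c assms mono unfolding is_join_def by blast
qed

lemma monoid_hom_le:
  assumes "h \<in> monoid_hom G H" "x \<in> carrier G" "y \<in> carrier G"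
  shows "le_L G x y \<Longrightarrow> le_L H (h x) (h y)" "le_R G x y \<Longrightarrow> le_R H (h x) (h y)"
  using assms by (auto simp: le_L_def le_R_def monoid_hom_def hom_def)

text \<open>The two retraction hypotheses make \<open>h\<close> preserve joins, so that closure under joins can be pulled back.\<close>

lemma parabolic_vimage:
  assumes G: "monoid G" and h: "h \<in> monoid_hom G H" and P: "parabolic P H"
    and retract_L: "\<And>d. d \<in> carrier H \<Longrightarrow> \<exists>p \<in> carrier G. \<forall>x \<in> carrier G. le_L H (h x) d \<longleftrightarrow> le_L G x p"
    and retract_R: "\<And>d. d \<in> carrier H \<Longrightarrow> \<exists>p \<in> carrier G. \<forall>x \<in> carrier G. le_R H (h x) d \<longleftrightarrow> le_R G x p"
  shows "parabolic {x \<in> carrier G. h x \<in> P} G"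
proof -
  interpret monoid G by (rule G)
  have hc: "h ` carrier G \<subseteq> carrier H" and hm: "\<And>x y. x \<in> carrier G \<Longrightarrow> y \<in> carrier G \<Longrightarrow>
      h (x \<otimes>\<^bsub>G\<^esub> y) = h x \<otimes>\<^bsub>H\<^esub> h y" and h1: "h \<one>\<^bsub>G\<^esub> = \<one>\<^bsub>H\<^esub>"
    using h by (auto simp: monoid_hom_def hom_def)
  note PD = parabolicD[OF P]
  have sub: "submonoid {x \<in> carrier G. h x \<in> P} G"
    by (rule submonoid.intro) (use PD h1 hm in auto)
  have ideal: "x \<in> {x \<in> carrier G. h x \<in> P} \<and> y \<in> {x \<in> carrier G. h x \<in> P}"
    if "x \<in> carrier G" "y \<in> carrier G" "x \<otimes>\<^bsub>G\<^esub> y \<in> {x \<in> carrier G. h x \<in> P}" for x y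
  proof -
    have "h x \<otimes>\<^bsub>H\<^esub> h y \<in> P" using that hm by simp
    then show ?thesis using PD(5)[of "h x" "h y"] that(1,2) hc by blast
  qed
  have join_L: "c \<in> {x \<in> carrier G. h x \<in> P}"
    if "a \<in> {x \<in> carrier G. h x \<in> P}" "b \<in> {x \<in> carrier G. h x \<in> P}"
      "is_join (le_L G) (carrier G) a b c" for a b c
  proof -
    have "is_join (le_L H) (carrier H) (h a) (h b) (h c)"
      using is_join_image[where r' = "le_L H" and h = h, OF that(3) hc _ _ monoid_hom_le(1)[OF h] retract_L]
        that(1,2) by simp
    then show ?thesis using that P unfolding parabolic_def is_join_def by blast
  qed
  have join_R: "c \<in> {x \<in> carrier G. h x \<in> P}"
    if "a \<in> {x \<in> carrier G. h x \<in> P}" "b \<in> {x \<in> carrier G. h x \<in> P}"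
      "is_join (le_R G) (carrier G) a b c" for a b c
  proof -
    have "is_join (le_R H) (carrier H) (h a) (h b) (h c)"
      using is_join_image[where r' = "le_R H" and h = h, OF that(3) hc _ _ monoid_hom_le(2)[OF h] retract_R]
        that(1,2) by simp
    then show ?thesis using that P unfolding parabolic_def is_join_def by blast
  qed
  show ?thesis
    unfolding parabolic_def
    by (intro conjI[OF sub] conjI ballI allI impI)
      ((rule ideal[THEN conjunct1] ideal[THEN conjunct2] join_L join_R; assumption)+)
qed

text \<open>The element \<open>p\<close> is the factor from \<open>N\<close> in the decomposition of \<open>d\<close> along the transversal.\<close>

lemma parabolic_embedding_retract_L:
  fixes M :: "'a monoid" and N :: "'c monoid"
  assumes M: "preGarside M" and N: "monoid N" and h: "parabolic_embedding h N M"
    and d: "d \<in> carrier M"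
  shows "\<exists>p \<in> carrier N. \<forall>x \<in> carrier N. le_L M (h x) d \<longleftrightarrow> le_L N x p"
proof -
  interpret M: monoid M using M by (simp add: preGarside_def)
  interpret N: monoid N by (rule N)
  note hD = parabolic_embeddingD[OF h]
  note free = parabolic_left_free[OF M N h]
  have exhaust: "\<exists>n \<in> carrier N. \<exists>s \<in> transversal h N M. a = h n \<otimes>\<^bsub>M\<^esub> s" if "a \<in> carrier M" for a
    using free that unfolding bij_betw_def by fastforce
  have unique: "n = n'"
    if "n \<in> carrier N" "n' \<in> carrier N" "s \<in> transversal h N M" "s' \<in> transversal h N M"
      "h n \<otimes>\<^bsub>M\<^esub> s = h n' \<otimes>\<^bsub>M\<^esub> s'" for n n' s s'
    using free that unfolding bij_betw_def inj_on_def by fastforce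
  obtain n s where ns: "n \<in> carrier N" "s \<in> transversal h N M" "d = h n \<otimes>\<^bsub>M\<^esub> s"
    using exhaust[OF d] by blast
  have s: "s \<in> carrier M" using ns by (simp add: transversal_def)
  have "le_L M (h x) d \<longleftrightarrow> le_L N x n" if x: "x \<in> carrier N" for x
  proof
    assume "le_L M (h x) d"
    then obtain r where r: "r \<in> carrier M" "d = h x \<otimes>\<^bsub>M\<^esub> r" by (auto simp: le_L_def)
    obtain k t where k: "k \<in> carrier N" "t \<in> transversal h N M" "r = h k \<otimes>\<^bsub>M\<^esub> t"
      using exhaust[OF r(1)] by blast
    then have "t \<in> carrier M" by (simp add: transversal_def)
    then have "h n \<otimes>\<^bsub>M\<^esub> s = h (x \<otimes>\<^bsub>N\<^esub> k) \<otimes>\<^bsub>M\<^esub> t"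
      using ns r k x hD(4) by (simp add: hD(5) M.m_assoc)
    then have "n = x \<otimes>\<^bsub>N\<^esub> k" using unique[of n "x \<otimes>\<^bsub>N\<^esub> k" s t] ns k x by simp
    then show "le_L N x n" using k by (auto simp: le_L_def)
  next
    assume "le_L N x n"
    then obtain k where "k \<in> carrier N" "n = x \<otimes>\<^bsub>N\<^esub> k" by (auto simp: le_L_def)
    then have "d = h x \<otimes>\<^bsub>M\<^esub> (h k \<otimes>\<^bsub>M\<^esub> s)" "h k \<otimes>\<^bsub>M\<^esub> s \<in> carrier M"
      using ns s x hD(4) by (simp_all add: hD(5) M.m_assoc)
    then show "le_L M (h x) d" by (auto simp: le_L_def)
  qed
  then show ?thesis using ns by blast
qed

lemma parabolic_embedding_retract_R:
  fixes M :: "'a monoid" and N :: "'c monoid"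
  assumes M: "preGarside M" and N: "monoid N" and h: "parabolic_embedding h N M"
    and d: "d \<in> carrier M"
  shows "\<exists>p \<in> carrier N. \<forall>x \<in> carrier N. le_R M (h x) d \<longleftrightarrow> le_R N x p"
  using parabolic_embedding_retract_L[OF preGarside_op_monoid[OF M] monoid_op_monoid[OF N]
      parabolic_embedding_op_monoid[OF h]] d by simp

section \<open>The amalgamated product of preGarside monoids\<close>

lemma (in amalg_data) cls_eqD: "v \<in> amalg_words M1 M2 \<Longrightarrow> cls u = cls v \<Longrightarrow> eqv u v"
  using cls_self[of v] by (auto simp: amalg_class_def)

text \<open>The copies of \<open>M1\<close> and \<open>M2\<close> inside the sum type, as a family indexed by \<^typ>\<open>bool\<close>: \<open>True\<close>
stands for \<open>M1\<close>, and \<^const>\<open>isl\<close> tells the factor of a letter.\<close>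

definition summand :: "'a monoid \<Rightarrow> 'b monoid \<Rightarrow> bool \<Rightarrow> ('a + 'b) monoid"
  where "summand M1 M2 i = (if i
    then \<lparr>carrier = Inl ` carrier M1, mult = \<lambda>x y. Inl (projl x \<otimes>\<^bsub>M1\<^esub> projl y), one = Inl \<one>\<^bsub>M1\<^esub>\<rparr>
    else \<lparr>carrier = Inr ` carrier M2, mult = \<lambda>x y. Inr (projr x \<otimes>\<^bsub>M2\<^esub> projr y), one = Inr \<one>\<^bsub>M2\<^esub>\<rparr>)"

definition summand_emb :: "('c \<Rightarrow> 'a) \<Rightarrow> ('c \<Rightarrow> 'b) \<Rightarrow> bool \<Rightarrow> 'c \<Rightarrow> 'a + 'b"
  where "summand_emb \<iota>1 \<iota>2 i n = (if i then Inl (\<iota>1 n) else Inr (\<iota>2 n))"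

definition summand_transversal ::
    "'a monoid \<Rightarrow> 'b monoid \<Rightarrow> 'c monoid \<Rightarrow> ('c \<Rightarrow> 'a) \<Rightarrow> ('c \<Rightarrow> 'b) \<Rightarrow> bool \<Rightarrow> ('a + 'b) set"
  where "summand_transversal M1 M2 N \<iota>1 \<iota>2 i =
    (if i then Inl ` transversal \<iota>1 N M1 else Inr ` transversal \<iota>2 N M2)"

lemma summand_simps [simp]:
  "carrier (summand M1 M2 True) = Inl ` carrier M1" "carrier (summand M1 M2 False) = Inr ` carrier M2"
  "Inl a \<otimes>\<^bsub>summand M1 M2 True\<^esub> Inl b = Inl (a \<otimes>\<^bsub>M1\<^esub> b)"
  "Inr c \<otimes>\<^bsub>summand M1 M2 False\<^esub> Inr d = Inr (c \<otimes>\<^bsub>M2\<^esub> d)"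
  "\<one>\<^bsub>summand M1 M2 True\<^esub> = Inl \<one>\<^bsub>M1\<^esub>" "\<one>\<^bsub>summand M1 M2 False\<^esub> = Inr \<one>\<^bsub>M2\<^esub>"
  by (simp_all add: summand_def)

lemma summand_emb_simps [simp]:
  "summand_emb \<iota>1 \<iota>2 True n = Inl (\<iota>1 n)" "summand_emb \<iota>1 \<iota>2 False n = Inr (\<iota>2 n)"
  by (simp_all add: summand_emb_def)

lemma le_L_summand [simp]:
  "le_L (summand M1 M2 True) (Inl a) (Inl b) \<longleftrightarrow> le_L M1 a b"
  "le_L (summand M1 M2 False) (Inr c) (Inr d) \<longleftrightarrow> le_L M2 c d"
  by (auto simp: le_L_def)

lemma monoid_summand:
  assumes "monoid M1" "monoid M2"
  shows "monoid (summand M1 M2 i)"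
proof -
  interpret M1: monoid M1 by (rule assms)
  interpret M2: monoid M2 by (rule assms)
  show ?thesis
    by (cases i; rule monoidI) (auto simp: M1.m_assoc M2.m_assoc)
qed

lemma rev_in_lists: "rev w \<in> lists B \<longleftrightarrow> w \<in> lists B"
  by (simp add: in_lists_conv_set)

lemma amalg_eq_rev:
  "amalg_eq M1 M2 N \<iota>1 \<iota>2 u v \<Longrightarrow>
    amalg_eq (op_monoid M1) (op_monoid M2) (op_monoid N) \<iota>1 \<iota>2 (rev u) (rev v)"
proof (induction rule: amalg_eq.induct)
  case (refl w)
  then show ?case by (intro amalg_eq.refl) (auto simp: amalg_words_def)
next
  case (sym v w)
  show ?case by (rule amalg_eq.sym[OF sym.IH])
next
  case (trans u v w)
  show ?case by (rule amalg_eq.trans[OF trans.IH])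
next
  case (append u u' v v')
  then show ?case by (simp add: amalg_eq.append)
next
  case one1
  then show ?case using amalg_eq.one1[of "op_monoid M1"] by simp
next
  case one2
  then show ?case using amalg_eq.one2[of _ "op_monoid M2"] by simp
next
  case (mult1 x y)
  then show ?case using amalg_eq.mult1[of y "op_monoid M1" x] by simp
next
  case (mult2 x y)
  then show ?case using amalg_eq.mult2[of y "op_monoid M2" x] by simp
next
  case (glue n)
  then show ?case using amalg_eq.glue[of n "op_monoid N"] by simp
qed

locale preGarside_amalgam =
  fixes M1 :: "'a monoid" and M2 :: "'b monoid" and N :: "'c monoid"
    and \<iota>1 :: "'c \<Rightarrow> 'a" and \<iota>2 :: "'c \<Rightarrow> 'b"
  assumes preGarside1: "preGarside M1" and preGarside2: "preGarside M2" and monoid_N: "monoid N"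
    and emb1: "parabolic_embedding \<iota>1 N M1" and emb2: "parabolic_embedding \<iota>2 N M2"
begin

lemma monoids: "monoid M1" "monoid M2"
  using preGarside1 preGarside2 by (simp_all add: preGarside_def)

sublocale amalg_data M1 M2 N \<iota>1 \<iota>2
  using monoids parabolic_embeddingD(4)[OF emb1] parabolic_embeddingD(4)[OF emb2]
  by (intro amalg_data.intro) auto

abbreviation "G \<equiv> summand M1 M2"
abbreviation "e \<equiv> summand_emb \<iota>1 \<iota>2"
abbreviation "T \<equiv> summand_transversal M1 M2 N \<iota>1 \<iota>2"

lemma left_free_G: "bij_betw (\<lambda>(n, s). e i n \<otimes>\<^bsub>G i\<^esub> s) (carrier N \<times> T i) (carrier (G i))"
proof (cases i)
  case True
  have "bij_betw Inl (carrier M1) (Inl ` carrier M1)"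
    by (simp add: bij_betw_def)
  note bij_betw_trans[OF parabolic_left_free[OF preGarside1 monoid_N emb1] this]
  moreover have "bij_betw (\<lambda>(n, s). (n, projl s)) (carrier N \<times> T i) (carrier N \<times> transversal \<iota>1 N M1)"
    by (rule bij_betw_byWitness[where f' = "\<lambda>(n, s). (n, Inl s)"])
      (auto simp: summand_transversal_def True)
  ultimately have "bij_betw ((Inl \<circ> (\<lambda>(n, s). \<iota>1 n \<otimes>\<^bsub>M1\<^esub> s)) \<circ> (\<lambda>(n, s). (n, projl s)))
      (carrier N \<times> T i) (Inl ` carrier M1)"
    by (blast intro: bij_betw_trans)
  then show ?thesis
    by (subst bij_betw_cong[where g = "(Inl \<circ> (\<lambda>(n, s). \<iota>1 n \<otimes>\<^bsub>M1\<^esub> s)) \<circ> (\<lambda>(n, s). (n, projl s))"])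
      (auto simp: True summand_transversal_def)
next
  case False
  have "bij_betw Inr (carrier M2) (Inr ` carrier M2)"
    by (simp add: bij_betw_def)
  note bij_betw_trans[OF parabolic_left_free[OF preGarside2 monoid_N emb2] this]
  moreover have "bij_betw (\<lambda>(n, s). (n, projr s)) (carrier N \<times> T i) (carrier N \<times> transversal \<iota>2 N M2)"
    by (rule bij_betw_byWitness[where f' = "\<lambda>(n, s). (n, Inr s)"])
      (auto simp: summand_transversal_def False)
  ultimately have "bij_betw ((Inr \<circ> (\<lambda>(n, s). \<iota>2 n \<otimes>\<^bsub>M2\<^esub> s)) \<circ> (\<lambda>(n, s). (n, projr s)))
      (carrier N \<times> T i) (Inr ` carrier M2)"
    by (blast intro: bij_betw_trans)
  then show ?thesis
    by (subst bij_betw_cong[where g = "(Inr \<circ> (\<lambda>(n, s). \<iota>2 n \<otimes>\<^bsub>M2\<^esub> s)) \<circ> (\<lambda>(n, s). (n, projr s))"])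
      (auto simp: False summand_transversal_def)
qed

sublocale fam: left_free_family G N e T isl
proof (rule left_free_family.intro)
  fix i
  show "monoid (G i)" by (rule monoid_summand[OF monoids])
  show "monoid N" by (rule monoid_N)
  show "e i \<in> monoid_hom N (G i)"
    using parabolic_embeddingD[OF emb1] parabolic_embeddingD[OF emb2]
    by (cases i) (auto simp: monoid_hom_def hom_def)
  show "\<one>\<^bsub>G i\<^esub> \<in> T i"
    using one_in_transversal[OF preGarside1 monoid_N emb1] one_in_transversal[OF preGarside2 monoid_N emb2]
    by (cases i) (auto simp: summand_transversal_def)
  show "T i \<subseteq> carrier (G i)"
    by (cases i) (auto simp: summand_transversal_def transversal_def)
  show "bij_betw (\<lambda>(n, s). e i n \<otimes>\<^bsub>G i\<^esub> s) (carrier N \<times> T i) (carrier (G i))"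
    by (rule left_free_G)
next
  fix x i assume "x \<in> carrier (G i)"
  then show "isl x = i" by (cases i) auto
qed

lemma words_eq: "amalg_words M1 M2 = lists fam.letters"
proof -
  have "fam.letters = carrier M1 <+> carrier M2"
    by (auto simp: fam.letters_def UNIV_bool)
  then show ?thesis by (simp add: amalg_words_def)
qed

lemma summand_cancel:
  assumes "x \<in> carrier (G i)" "a \<in> carrier (G i)" "b \<in> carrier (G i)"
    and "x \<otimes>\<^bsub>G i\<^esub> a = x \<otimes>\<^bsub>G i\<^esub> b"
  shows "a = b"
  using assms preGarside_l_cancel[OF preGarside1] preGarside_l_cancel[OF preGarside2]
  by (cases i) auto

lemma summand_factor:
  assumes "a \<in> carrier (G i)" "b \<in> carrier (G i)" "a \<otimes>\<^bsub>G i\<^esub> b \<in> e i ` carrier N"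
  shows "a \<in> e i ` carrier N"
proof (cases i)
  case True
  then obtain x y where "x \<in> carrier M1" "y \<in> carrier M1" "a = Inl x" "b = Inl y"
    using assms by auto
  then show ?thesis
    using parabolicD(5)[OF parabolic_embeddingD(3)[OF emb1], of x y] assms(3) True by auto
next
  case False
  then obtain x y where "x \<in> carrier M2" "y \<in> carrier M2" "a = Inr x" "b = Inr y"
    using assms by auto
  then show ?thesis
    using parabolicD(5)[OF parabolic_embeddingD(3)[OF emb2], of x y] assms(3) False by auto
qed

lemma summand_norm:
  obtains \<nu> :: "bool \<Rightarrow> 'a + 'b \<Rightarrow> nat"
  where "\<And>i a. a \<in> carrier (G i) \<Longrightarrow> a \<noteq> \<one>\<^bsub>G i\<^esub> \<Longrightarrow> \<nu> i a > 0"
    and "\<And>i a b. a \<in> carrier (G i) \<Longrightarrow> b \<in> carrier (G i) \<Longrightarrow> \<nu> i (a \<otimes>\<^bsub>G i\<^esub> b) \<ge> \<nu> i a + \<nu> i b"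
proof -
  obtain \<nu>1 :: "'a \<Rightarrow> nat" where \<nu>1: "\<And>a. a \<in> carrier M1 \<Longrightarrow> a \<noteq> \<one>\<^bsub>M1\<^esub> \<Longrightarrow> \<nu>1 a > 0"
    "\<And>a b. a \<in> carrier M1 \<Longrightarrow> b \<in> carrier M1 \<Longrightarrow> \<nu>1 (a \<otimes>\<^bsub>M1\<^esub> b) \<ge> \<nu>1 a + \<nu>1 b"
    using preGarside1 unfolding preGarside_def atomic_def by blast
  obtain \<nu>2 :: "'b \<Rightarrow> nat" where \<nu>2: "\<And>a. a \<in> carrier M2 \<Longrightarrow> a \<noteq> \<one>\<^bsub>M2\<^esub> \<Longrightarrow> \<nu>2 a > 0"
    "\<And>a b. a \<in> carrier M2 \<Longrightarrow> b \<in> carrier M2 \<Longrightarrow> \<nu>2 (a \<otimes>\<^bsub>M2\<^esub> b) \<ge> \<nu>2 a + \<nu>2 b"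
    using preGarside2 unfolding preGarside_def atomic_def by blast
  show ?thesis
  proof (rule that[of "\<lambda>_. case_sum \<nu>1 \<nu>2"])
    fix i a assume "a \<in> carrier (G i)" "a \<noteq> \<one>\<^bsub>G i\<^esub>"
    then show "case_sum \<nu>1 \<nu>2 a > 0"
      using \<nu>1(1) \<nu>2(1) by (cases a; cases i) force+
  next
    fix i a b assume "a \<in> carrier (G i)" "b \<in> carrier (G i)"
    then show "case_sum \<nu>1 \<nu>2 (a \<otimes>\<^bsub>G i\<^esub> b) \<ge> case_sum \<nu>1 \<nu>2 a + case_sum \<nu>1 \<nu>2 b"
      using \<nu>1(2) \<nu>2(2) by (cases i) auto
  qed
qed

lemma eqv_run:
  assumes "eqv u v" "\<sigma> \<in> fam.states"
  shows "fam.run u \<sigma> = fam.run v \<sigma>"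
  using assms
proof (induction arbitrary: \<sigma> rule: amalg_eq.induct)
  case (append u u' v v')
  then have "fam.run v' \<sigma> \<in> fam.states"
    using eqv_words words_eq fam.run_in_states by metis
  with append show ?case by (simp add: fam.run_append)
next
  case one1
  then show ?case using fam.act_one[of \<sigma> True] by simp
next
  case one2
  then show ?case using fam.act_one[of \<sigma> False] by simp
next
  case (mult1 x y)
  then show ?case using fam.act_mult[of "Inl x" True "Inl y" \<sigma>] by simp
next
  case (mult2 x y)
  then show ?case using fam.act_mult[of "Inr x" False "Inr y" \<sigma>] by simp
next
  case (glue n)
  then show ?case
    by (cases \<sigma>) (metis fam.act_e fam.run_Cons fam.run_Nil summand_emb_simps)
qed simp_all

lemma cls_letter_mult:
  assumes "x \<in> carrier (G i)" "y \<in> carrier (G i)"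
  shows "cls [x \<otimes>\<^bsub>G i\<^esub> y] = cls [x] \<otimes>\<^bsub>A\<^esub> cls [y]"
proof (cases i)
  case True
  with assms obtain a b where "a \<in> carrier M1" "b \<in> carrier M1" "x = Inl a" "y = Inl b" by auto
  then show ?thesis
    using inl_hom True by (auto simp: amalg_inl_def monoid_hom_def hom_def)
next
  case False
  with assms obtain a b where "a \<in> carrier M2" "b \<in> carrier M2" "x = Inr a" "y = Inr b" by auto
  then show ?thesis
    using inr_hom False by (auto simp: amalg_inr_def monoid_hom_def hom_def)
qed

lemma cls_letter_one: "cls [\<one>\<^bsub>G i\<^esub>] = \<one>\<^bsub>A\<^esub>"
  using inl_hom inr_hom by (cases i) (auto simp: amalg_inl_def amalg_inr_def monoid_hom_def)

lemma cls_letter_e: "n \<in> carrier N \<Longrightarrow> cls [e i n] = cls [e j n]"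
  using inl_inr_glue[of n] by (cases i; cases j) (auto simp: amalg_inl_def amalg_inr_def)

lemma cls_Cons:
  assumes "x \<in> fam.letters" "w \<in> amalg_words M1 M2"
  shows "cls (x # w) = cls [x] \<otimes>\<^bsub>A\<^esub> cls w"
  using mult_cls[of "[x]" w] assms by (simp add: words_eq)

lemma cls_in_carrier: "w \<in> amalg_words M1 M2 \<Longrightarrow> cls w \<in> carrier A"
  by (simp add: carrier_A)

section \<open>Amalgams of parabolic submonoids\<close>

context
  fixes M1' :: "'a set" and M2' :: "'b set" and N' :: "'c set"
  assumes par1: "parabolic M1' M1" and par2: "parabolic M2' M2"
    and trace1: "{n \<in> carrier N. \<iota>1 n \<in> M1'} = N'" and trace2: "{n \<in> carrier N. \<iota>2 n \<in> M2'} = N'"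
begin

abbreviation "P \<equiv> M1' <+> M2'"
abbreviation "M1r \<equiv> restrict_monoid M1 M1'"
abbreviation "M2r \<equiv> restrict_monoid M2 M2'"
abbreviation "Nr \<equiv> restrict_monoid N N'"

lemma sub_words: "amalg_words M1r M2r = lists P"
  by (simp add: amalg_words_def)

lemma P_letters: "P \<subseteq> fam.letters"
  using parabolicD(2)[OF par1] parabolicD(2)[OF par2] by (auto simp: fam.letters_def UNIV_bool)

lemma lists_P: "w \<in> lists P \<Longrightarrow> w \<in> amalg_words M1 M2"
  using P_letters words_eq by (auto simp: lists_mono subsetD)

lemma P_mult:
  assumes "x \<in> carrier (G i)" "y \<in> carrier (G i)"
  shows "x \<otimes>\<^bsub>G i\<^esub> y \<in> P \<longleftrightarrow> x \<in> P \<and> y \<in> P"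
  using assms parabolic_mult_iff[OF par1] parabolic_mult_iff[OF par2] by (cases i) auto

lemma P_one: "\<one>\<^bsub>G i\<^esub> \<in> P"
  using parabolicD(3)[OF par1] parabolicD(3)[OF par2] by (cases i) auto

lemma P_e: "n \<in> carrier N \<Longrightarrow> e i n \<in> P \<longleftrightarrow> n \<in> N'"
  using trace1 trace2 by (cases i) auto

interpretation sub: amalg_data M1r M2r Nr \<iota>1 \<iota>2
proof (rule amalg_data.intro)
  show "monoid M1r" "monoid M2r"
    using submonoid.submonoid_is_monoid parabolicD(1)[OF par1] parabolicD(1)[OF par2] monoids by blast+
  show "\<iota>1 \<in> carrier Nr \<rightarrow> carrier M1r" "\<iota>2 \<in> carrier Nr \<rightarrow> carrier M2r"
    using trace1 trace2 by auto
qed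

lemma sub_cls_eval:
  assumes "w \<in> lists P"
  shows "sub.cls w = foldr (\<lambda>x k. sub.cls [x] \<otimes>\<^bsub>sub.A\<^esub> k) w \<one>\<^bsub>sub.A\<^esub>"
  using assms
proof (induction w)
  case Nil
  then show ?case by (simp add: sub.one_A)
next
  case (Cons x w)
  then show ?case using sub.mult_cls[of "[x]" w] by (simp add: sub_words)
qed

text \<open>Words over \<open>P\<close> with the same normal form in the large amalgam are already equal in the small one:
evaluation in the small amalgam depends on the normal form alone.\<close>

lemma nf_eq_imp_sub_eqv:
  assumes "u \<in> lists P" "v \<in> lists P" "fam.nf u = fam.nf v"
  shows "sub.eqv u v"
proof -
  have "foldr (\<lambda>x k. sub.cls [x] \<otimes>\<^bsub>sub.A\<^esub> k) u \<one>\<^bsub>sub.A\<^esub> =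
    foldr (\<lambda>x k. sub.cls [x] \<otimes>\<^bsub>sub.A\<^esub> k) v \<one>\<^bsub>sub.A\<^esub>"
  proof (rule fam.nf_determines_eval[where P = P])
    show "monoid sub.A" by (rule sub.monoid_A)
    show "P \<subseteq> fam.letters" by (rule P_letters)
    show "\<one>\<^bsub>G i\<^esub> \<in> P" for i by (rule P_one)
    show "x \<otimes>\<^bsub>G i\<^esub> y \<in> P \<longleftrightarrow> x \<in> P \<and> y \<in> P" if "x \<in> carrier (G i)" "y \<in> carrier (G i)" for x y i
      using P_mult[OF that] .
    show "e j n \<in> P" if "n \<in> carrier N" "e i n \<in> P" for i j n
      using P_e that by simp
    show "sub.cls [x] \<in> carrier sub.A" if "x \<in> P" for x
      using that by (simp add: sub.carrier_A sub_words)
    show "sub.cls [\<one>\<^bsub>G i\<^esub>] = \<one>\<^bsub>sub.A\<^esub>" for i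
      using sub.inl_hom sub.inr_hom by (cases i) (auto simp: amalg_inl_def amalg_inr_def monoid_hom_def)
    show "sub.cls [x \<otimes>\<^bsub>G i\<^esub> y] = sub.cls [x] \<otimes>\<^bsub>sub.A\<^esub> sub.cls [y]"
      if "x \<in> carrier (G i)" "y \<in> carrier (G i)" "x \<in> P" "y \<in> P" for x y i
      using that sub.inl_hom sub.inr_hom
      by (cases i) (auto simp: amalg_inl_def amalg_inr_def monoid_hom_def hom_def)
    show "sub.cls [e i n] = sub.cls [e j n]" if "n \<in> carrier N" "e i n \<in> P" for i j n
    proof -
      have "n \<in> carrier Nr" using P_e[OF that(1), of i] that(2) by simp
      then show ?thesis
        using sub.inl_inr_glue[of n] by (cases i; cases j) (auto simp: amalg_inl_def amalg_inr_def)
    qed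
  qed (use assms in simp_all)
  then have "sub.cls u = sub.cls v" using sub_cls_eval assms by simp
  then show ?thesis using sub.cls_eqD assms(2) sub_words by simp
qed

text \<open>Each generating relation has both sides over \<open>P\<close> or neither: for products this is closure under factors,
for the gluing relation it is the equality of the two traces.\<close>

lemma eqv_lists_P: "eqv u v \<Longrightarrow> u \<in> lists P \<longleftrightarrow> v \<in> lists P"
proof (induction rule: amalg_eq.induct)
  case (mult1 x y)
  then show ?case using P_mult[of "Inl x" True "Inl y"] by simp
next
  case (mult2 x y)
  then show ?case using P_mult[of "Inr x" False "Inr y"] by simp
next
  case (glue n)
  then show ?case using P_e[of n True] P_e[of n False] by simp
next
  case one1
  then show ?case using P_one[of True] by simp
next
  case one2
  then show ?case using P_one[of False] by simp
qed auto


abbreviation "Q \<equiv> cls ` lists P"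
abbreviation "canon \<equiv> amalg_canon M1 M2 N \<iota>1 \<iota>2"

lemma cls_in_Q_iff: "w \<in> amalg_words M1 M2 \<Longrightarrow> cls w \<in> Q \<longleftrightarrow> w \<in> lists P"
proof
  assume w: "w \<in> amalg_words M1 M2" and "cls w \<in> Q"
  then obtain v where v: "v \<in> lists P" "cls w = cls v" by blast
  then have "eqv v w" using cls_eqD[OF w] by simp
  then show "w \<in> lists P" using eqv_lists_P v by blast
qed simp

lemma Q_carrier: "Q \<subseteq> carrier A"
  using lists_P by (auto simp: carrier_A)

lemma Q_mult:
  assumes "a \<in> carrier A" "b \<in> carrier A"
  shows "a \<otimes>\<^bsub>A\<^esub> b \<in> Q \<longleftrightarrow> a \<in> Q \<and> b \<in> Q"
proof -
  obtain u v where uv: "u \<in> amalg_words M1 M2" "v \<in> amalg_words M1 M2" "a = cls u" "b = cls v"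
    using assms by (auto simp: carrier_A)
  have "cls (u @ v) \<in> Q \<longleftrightarrow> u @ v \<in> lists P" using uv by (intro cls_in_Q_iff) simp
  then show ?thesis using uv cls_in_Q_iff by (simp add: mult_cls)
qed

lemma Q_submonoid: "submonoid Q A"
proof (rule submonoid.intro)
  show "Q \<subseteq> carrier A" by (rule Q_carrier)
  show "a \<otimes>\<^bsub>A\<^esub> b \<in> Q" if "a \<in> Q" "b \<in> Q" for a b
    using that Q_mult Q_carrier by (simp add: subsetD)
  show "\<one>\<^bsub>A\<^esub> \<in> Q" by (auto simp: one_A)
qed

lemma sub_carrier: "carrier sub.A = sub.cls ` lists P"
  by (simp add: sub.carrier_A sub_words)

lemma word_eval_cls: "w \<in> amalg_words M1 M2 \<Longrightarrow> word_eval A inl inr w = cls w"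
proof (induction w)
  case Nil
  then show ?case by (simp add: word_eval_def one_A)
next
  case (Cons x w)
  then have "case_sum inl inr x = cls [x]" "w \<in> amalg_words M1 M2" "x \<in> fam.letters"
    by (auto simp: amalg_inl_def amalg_inr_def words_eq split: sum.split)
  then show ?case using Cons.IH cls_Cons[of x w] by (simp add: word_eval_def)
qed

lemma restricted_homs:
  "inl \<in> monoid_hom M1r A" "inr \<in> monoid_hom M2r A"
  using inl_hom inr_hom parabolicD(2)[OF par1] parabolicD(2)[OF par2]
  by (auto simp: monoid_hom_def hom_def subset_iff Pi_iff)

lemma restricted_glue: "n \<in> carrier Nr \<Longrightarrow> inl (\<iota>1 n) = inr (\<iota>2 n)"
  using trace1 inl_inr_glue by auto

lemma canon_cls: "w \<in> lists P \<Longrightarrow> canon (sub.cls w) = cls w"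
  using sub.amalg_lift_cls[OF monoid_A restricted_homs restricted_glue] word_eval_cls lists_P
  by (simp add: amalg_canon_def sub_words)

lemma canon_hom: "canon \<in> monoid_hom sub.A A"
  using sub.amalg_lift_hom[OF monoid_A restricted_homs restricted_glue] by (simp add: amalg_canon_def)

lemma canon_inj: "inj_on canon (carrier sub.A)"
proof (rule inj_onI)
  fix X Y assume "X \<in> carrier sub.A" "Y \<in> carrier sub.A" and eq: "canon X = canon Y"
  then obtain u v where uv: "u \<in> lists P" "v \<in> lists P" "X = sub.cls u" "Y = sub.cls v"
    by (auto simp: sub_carrier)
  then have "cls u = cls v" using canon_cls eq by simp
  then have "eqv u v" using cls_eqD[of v u] lists_P uv by simp
  then have "fam.nf u = fam.nf v" using eqv_run by (simp add: fam.nf_def)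
  then show "X = Y" using nf_eq_imp_sub_eqv uv sub.cls_eqI by simp
qed

lemma canon_image: "canon ` carrier sub.A = Q"
  using canon_cls by (force simp: sub_carrier image_image)

lemma canon_iso: "canon \<in> iso sub.A (restrict_monoid A Q)"
  using canon_hom canon_inj canon_image
  by (auto simp: iso_def bij_betw_def monoid_hom_def hom_def)

end

section \<open>Divisors in the amalgam\<close>

lemma cls_eq_iff:
  assumes "u \<in> amalg_words M1 M2" "v \<in> amalg_words M1 M2"
  shows "cls u = cls v \<longleftrightarrow> fam.nf u = fam.nf v"
proof
  assume "cls u = cls v"
  then have "eqv u v" using cls_eqD[OF assms(2)] by simp
  then show "fam.nf u = fam.nf v" using eqv_run by (simp add: fam.nf_def)
next
  assume eq: "fam.nf u = fam.nf v"
  have "{n \<in> carrier N. \<iota>1 n \<in> carrier M1} = carrier N" "{n \<in> carrier N. \<iota>2 n \<in> carrier M2} = carrier N"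
    using \<iota>1 \<iota>2 by auto
  then have "eqv u v"
    using nf_eq_imp_sub_eqv[OF parabolic_carrier[OF M1] parabolic_carrier[OF M2], of "carrier N" u v]
      eq assms by (simp add: amalg_words_def)
  then show "cls u = cls v" by (rule cls_eqI)
qed

definition state_word :: "'c \<times> ('a + 'b) list \<Rightarrow> ('a + 'b) list"
  where "state_word \<sigma> = e True (fst \<sigma>) # snd \<sigma>"

lemma state_word:
  assumes "\<sigma> \<in> fam.states"
  shows "state_word \<sigma> \<in> amalg_words M1 M2" "fam.nf (state_word \<sigma>) = \<sigma>"
proof -
  obtain n w where \<sigma>: "\<sigma> = (n, w)" by (cases \<sigma>)
  then have "n \<in> carrier N" "fam.reduced w" using assms by (simp_all add: fam.states_def)
  moreover have "w \<in> lists fam.letters" using \<open>fam.reduced w\<close>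
    by (induction w) (auto dest: fam.S_closed fam.letters_closed)
  ultimately show "state_word \<sigma> \<in> amalg_words M1 M2"
    using \<sigma> fam.letters_closed[OF fam.e_closed[of n True]] by (simp add: state_word_def words_eq)
  show "fam.nf (state_word \<sigma>) = \<sigma>" using fam.nf_state[of n w True] assms \<sigma> by (simp add: state_word_def)
qed

lemma nf_states: "w \<in> amalg_words M1 M2 \<Longrightarrow> fam.nf w \<in> fam.states"
  using fam.nf_in_states words_eq by simp

text \<open>Left division by an element of a factor is decided within that factor, on the first syllable of the
normal form with respect to it.\<close>

lemma letter_divides_iff:
  assumes x: "x \<in> carrier (G i)" and d: "d \<in> amalg_words M1 M2"
  shows "le_L A (cls [x]) (cls d) \<longleftrightarrow> le_L (G i) x (fst (fam.peel i (fam.nf d)))"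
proof -
  have xl: "x \<in> fam.letters" using x by (rule fam.letters_closed)
  have "le_L A (cls [x]) (cls d) \<longleftrightarrow> (\<exists>\<tau> \<in> fam.states. fam.act x \<tau> = fam.nf d)"
  proof
    assume "le_L A (cls [x]) (cls d)"
    then obtain v where v: "v \<in> amalg_words M1 M2" "cls d = cls [x] \<otimes>\<^bsub>A\<^esub> cls v"
      unfolding le_L_def carrier_A by blast
    then have "cls d = cls (x # v)" using cls_Cons[OF xl v(1)] by simp
    then have "fam.nf d = fam.act x (fam.nf v)"
      using cls_eq_iff[OF d, of "x # v"] xl v(1) by (simp add: words_eq fam.nf_def)
    then show "\<exists>\<tau> \<in> fam.states. fam.act x \<tau> = fam.nf d" using nf_states[OF v(1)] by auto
  next
    assume "\<exists>\<tau> \<in> fam.states. fam.act x \<tau> = fam.nf d"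
    then obtain \<tau> where \<tau>: "\<tau> \<in> fam.states" "fam.act x \<tau> = fam.nf d" by blast
    note w = state_word[OF \<tau>(1)]
    have "fam.nf (x # state_word \<tau>) = fam.nf d" using w(2) \<tau>(2) by (simp add: fam.nf_def)
    then have "cls d = cls (x # state_word \<tau>)" using cls_eq_iff[OF d] w(1) xl by (simp add: words_eq)
    then show "le_L A (cls [x]) (cls d)" using le_LI[OF cls_in_carrier[OF w(1)]] cls_Cons[OF xl w(1)] by simp
  qed
  then show ?thesis using fam.act_solvable_iff[OF x nf_states[OF d]] by simp
qed

lemma A_l_cancel:
  assumes "x \<in> carrier A" "b \<in> carrier A" "c \<in> carrier A" "x \<otimes>\<^bsub>A\<^esub> b = x \<otimes>\<^bsub>A\<^esub> c"
  shows "b = c"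
proof -
  obtain w u v where w: "w \<in> amalg_words M1 M2" "x = cls w"
    and uv: "u \<in> amalg_words M1 M2" "v \<in> amalg_words M1 M2" "b = cls u" "c = cls v"
    using assms by (auto simp: carrier_A)
  have "fam.nf u = fam.nf v" if "fam.nf (w @ u) = fam.nf (w @ v)" using w(1) that
  proof (induction w)
    case (Cons x w)
    then have "x \<in> fam.letters" "w \<in> amalg_words M1 M2" by (simp_all add: words_eq)
    then obtain i where x: "x \<in> carrier (G i)" by (blast elim: fam.lettersE)
    have "fam.nf (w @ u) = fam.nf (w @ v)"
    proof (rule fam.act_l_cancel[OF x])
      show "fam.nf (w @ u) \<in> fam.states" "fam.nf (w @ v) \<in> fam.states"
        using nf_states \<open>w \<in> amalg_words M1 M2\<close> uv by simp_all
      show "fam.act x (fam.nf (w @ u)) = fam.act x (fam.nf (w @ v))"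
        using Cons.prems by (simp add: fam.nf_def)
    qed (rule summand_cancel[OF x])
    then show ?case using Cons.IH \<open>w \<in> amalg_words M1 M2\<close> by simp
  qed simp
  moreover have "fam.nf (w @ u) = fam.nf (w @ v)"
    using assms(4) w uv cls_eq_iff[of "w @ u" "w @ v"] by (simp add: mult_cls)
  ultimately show ?thesis using cls_eq_iff uv by simp
qed

text \<open>The complexity of the normal form drops with every nontrivial letter that is split off. Comparing
letter by letter matters, since the norms of the two factors need not agree on \<open>N\<close>.\<close>

lemma wf_right_divisors:
  "wf {(d', d). d' \<in> carrier A \<and> (\<exists>z \<in> carrier A - {\<one>\<^bsub>A\<^esub>}. d = z \<otimes>\<^bsub>A\<^esub> d')}"
proof -
  obtain \<nu> where \<nu>: "\<And>i a. a \<in> carrier (G i) \<Longrightarrow> a \<noteq> \<one>\<^bsub>G i\<^esub> \<Longrightarrow> \<nu> i a > (0::nat)"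
    "\<And>i a b. a \<in> carrier (G i) \<Longrightarrow> b \<in> carrier (G i) \<Longrightarrow> \<nu> i (a \<otimes>\<^bsub>G i\<^esub> b) \<ge> \<nu> i a + \<nu> i b"
    by (rule summand_norm) blast
  let ?r = "less_than <*lex*> less_than"
  let ?c = "fam.complexity \<nu>"
  have step: "cls w = \<one>\<^bsub>A\<^esub> \<or> (?c \<tau>, ?c (fam.run w \<tau>)) \<in> ?r"
    if "w \<in> amalg_words M1 M2" "\<tau> \<in> fam.states" for w \<tau>
    using that(1)
  proof (induction w)
    case Nil
    then show ?case by (simp add: one_A)
  next
    case (Cons x w)
    then have xw: "x \<in> fam.letters" "w \<in> amalg_words M1 M2" by (simp_all add: words_eq)
    then obtain i where x: "x \<in> carrier (G i)" by (blast elim: fam.lettersE)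
    have st: "fam.run w \<tau> \<in> fam.states" using fam.run_in_states xw(2) that(2) words_eq by simp
    have w: "fam.run w \<tau> = \<tau> \<or> (?c \<tau>, ?c (fam.run w \<tau>)) \<in> ?r"
    proof (cases "cls w = \<one>\<^bsub>A\<^esub>")
      case True
      then have "eqv w []" using cls_eqD[of "[]" w] by (simp add: one_A)
      then show ?thesis using eqv_run[of w "[]" \<tau>] that(2) by simp
    next
      case False
      then show ?thesis using Cons.IH xw by blast
    qed
    show ?case
    proof (cases "x = \<one>\<^bsub>G i\<^esub>")
      case True
      then have "cls (x # w) = cls w" "fam.run (x # w) \<tau> = fam.run w \<tau>"
        using cls_Cons[OF xw] cls_letter_one[of i] fam.act_one[OF st, of i] monoid.l_one[OF monoid_A]
          cls_in_carrier[OF xw(2)] by simp_all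
      then show ?thesis using Cons.IH xw by simp
    next
      case False
      have "(?c (fam.run w \<tau>), ?c (fam.act x (fam.run w \<tau>))) \<in> ?r"
        by (rule fam.complexity_act[OF \<nu> summand_factor x False st])
      moreover have "trans ?r" by simp
      ultimately show ?thesis using w unfolding trans_def by (metis fam.run_Cons)
    qed
  qed
  let ?m = "\<lambda>d. ?c (fam.nf (inv_into (amalg_words M1 M2) cls d))"
  have m: "?m (cls w) = ?c (fam.nf w)" if "w \<in> amalg_words M1 M2" for w
  proof -
    have "cls (inv_into (amalg_words M1 M2) cls (cls w)) = cls w"
      "inv_into (amalg_words M1 M2) cls (cls w) \<in> amalg_words M1 M2"
      using that f_inv_into_f[of "cls w" cls] inv_into_into[of "cls w" cls] by simp_all
    then show ?thesis using cls_eq_iff that by simp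
  qed
  have "{(d', d). d' \<in> carrier A \<and> (\<exists>z \<in> carrier A - {\<one>\<^bsub>A\<^esub>}. d = z \<otimes>\<^bsub>A\<^esub> d')} \<subseteq> inv_image ?r ?m"
  proof (rule subsetI)
    fix q assume "q \<in> {(d', d). d' \<in> carrier A \<and> (\<exists>z \<in> carrier A - {\<one>\<^bsub>A\<^esub>}. d = z \<otimes>\<^bsub>A\<^esub> d')}"
    then obtain d' z where q: "q = (d', z \<otimes>\<^bsub>A\<^esub> d')"
      and "d' \<in> carrier A" "z \<in> carrier A" "z \<noteq> \<one>\<^bsub>A\<^esub>" by auto
    then obtain u w where uw: "u \<in> amalg_words M1 M2" "d' = cls u" "w \<in> amalg_words M1 M2" "z = cls w"
      and "cls w \<noteq> \<one>\<^bsub>A\<^esub>" by (auto simp: carrier_A)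
    then have "(?c (fam.nf u), ?c (fam.run w (fam.nf u))) \<in> ?r" using step nf_states by blast
    moreover have "fam.run w (fam.nf u) = fam.nf (w @ u)" by (simp add: fam.nf_def fam.run_append)
    ultimately show "q \<in> inv_image ?r ?m" using q uw m[of "w @ u"] m[of u] by (simp add: mult_cls)
  qed
  moreover have "wf (inv_image ?r ?m)" by (intro wf_inv_image wf_lex_prod wf_less_than)
  ultimately show ?thesis by (rule wf_subset[rotated])
qed


lemma cls_letter_le:
  assumes "x \<in> carrier (G i)" "le_L (G i) x y"
  shows "le_L A (cls [x]) (cls [y])"
proof -
  obtain z where "z \<in> carrier (G i)" "y = x \<otimes>\<^bsub>G i\<^esub> z" using assms(2) by (auto simp: le_L_def)
  moreover have "cls [z] \<in> carrier A"
    using cls_in_carrier[of "[z]"] fam.letters_closed[OF \<open>z \<in> carrier (G i)\<close>] by (simp add: words_eq)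
  ultimately show ?thesis using le_LI[of "cls [z]" A] cls_letter_mult[OF assms(1)] by simp
qed

lemma retract_L:
  assumes "d \<in> carrier A"
  shows "\<exists>p \<in> carrier (G i). \<forall>x \<in> carrier (G i). le_L A (cls [x]) d \<longleftrightarrow> le_L (G i) x p"
proof -
  obtain w where w: "w \<in> amalg_words M1 M2" "d = cls w" using assms by (auto simp: carrier_A)
  have "fst (fam.peel i (fam.nf w)) \<in> carrier (G i)"
    using fam.peel_in_peeled[OF nf_states[OF w(1)], of i] by (auto simp: fam.peeled_def)
  then show ?thesis using letter_divides_iff w by blast
qed

lemma inl_retract_L:
  assumes "d \<in> carrier A"
  shows "\<exists>p \<in> carrier M1. \<forall>x \<in> carrier M1. le_L A (inl x) d \<longleftrightarrow> le_L M1 x p"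
  using retract_L[OF assms, of True] by (auto simp: amalg_inl_def)

lemma inr_retract_L:
  assumes "d \<in> carrier A"
  shows "\<exists>p \<in> carrier M2. \<forall>x \<in> carrier M2. le_L A (inr x) d \<longleftrightarrow> le_L M2 x p"
  using retract_L[OF assms, of False] by (auto simp: amalg_inr_def)

text \<open>The generators to which \<open>directed_divisors\<close> is applied are the letters of \<open>M1'\<close> and \<open>M2'\<close>. Two
letters from different factors are brought to the same side first: one of them divides an element of
\<open>N\<close>, hence lies in \<open>N\<close>.\<close>

lemma common_multiple_L:
  assumes par: "parabolic M1' M1" "parabolic M2' M2"
    and trace: "{n \<in> carrier N. \<iota>1 n \<in> M1'} = N'" "{n \<in> carrier N. \<iota>2 n \<in> M2'} = N'"
    and d: "d \<in> carrier A" and ab: "a \<in> cls ` lists (M1' <+> M2')" "b \<in> cls ` lists (M1' <+> M2')"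
      "le_L A a d" "le_L A b d"
  shows "\<exists>c \<in> cls ` lists (M1' <+> M2'). le_L A a c \<and> le_L A b c"
proof -
  let ?P = "M1' <+> M2'" and ?Q = "cls ` lists (M1' <+> M2')"
  note inP = P_letters[OF par trace] lists_P[OF par trace] P_mult[OF par trace] P_e[OF par trace]
  interpret A: monoid A by (rule monoid_A)
  have same_side: "\<exists>z \<in> ?Q. le_L A (cls [x]) z \<and> le_L A (cls [y]) z \<and> le_L A z (cls w)"
    if xy: "x \<in> ?P" "y \<in> ?P" "x \<in> carrier (G i)" "y \<in> carrier (G i)" and w: "w \<in> amalg_words M1 M2"
      and div: "le_L A (cls [x]) (cls w)" "le_L A (cls [y]) (cls w)" for x y w i
  proof -
    let ?p = "fst (fam.peel i (fam.nf w))"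
    have p: "?p \<in> carrier (G i)"
      using fam.peel_in_peeled[OF nf_states[OF w], of i] by (auto simp: fam.peeled_def)
    have le: "le_L (G i) x ?p" "le_L (G i) y ?p"
      using letter_divides_iff[OF xy(3) w] letter_divides_iff[OF xy(4) w] div by simp_all
    have "\<exists>z \<in> ?P. z \<in> carrier (G i) \<and> le_L (G i) x z \<and> le_L (G i) y z \<and> le_L (G i) z ?p"
    proof (cases i)
      case True
      obtain p' where "?p = Inl p'" "p' \<in> carrier M1" using p True by auto
      moreover obtain x' y' where "x = Inl x'" "x' \<in> M1'" "y = Inl y'" "y' \<in> M1'"
        using xy True by auto
      ultimately have eq: "x = Inl x'" "y = Inl y'" "?p = Inl p'" "x' \<in> M1'" "y' \<in> M1'" "p' \<in> carrier M1"
        by simp_all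
      then have "le_L M1 x' p'" "le_L M1 y' p'" using le True by simp_all
      then obtain z where "z \<in> M1'" "le_L M1 x' z" "le_L M1 y' z" "le_L M1 z p'"
        using parabolic_directed[OF preGarside1 par(1)] eq by blast
      then show ?thesis
        using True eq parabolicD(2)[OF par(1)] by (intro bexI[of _ "Inl z"]) auto
    next
      case False
      obtain p' where "?p = Inr p'" "p' \<in> carrier M2" using p False by auto
      moreover obtain x' y' where "x = Inr x'" "x' \<in> M2'" "y = Inr y'" "y' \<in> M2'"
        using xy False by auto
      ultimately have eq: "x = Inr x'" "y = Inr y'" "?p = Inr p'" "x' \<in> M2'" "y' \<in> M2'" "p' \<in> carrier M2"
        by simp_all
      then have "le_L M2 x' p'" "le_L M2 y' p'" using le False by simp_all
      then obtain z where "z \<in> M2'" "le_L M2 x' z" "le_L M2 y' z" "le_L M2 z p'"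
        using parabolic_directed[OF preGarside2 par(2)] eq by blast
      then show ?thesis
        using False eq parabolicD(2)[OF par(2)] by (intro bexI[of _ "Inr z"]) auto
    qed
    then obtain z where z: "z \<in> ?P" "z \<in> carrier (G i)" "le_L (G i) x z" "le_L (G i) y z" "le_L (G i) z ?p"
      by blast
    then have "le_L A (cls [x]) (cls [z])" "le_L A (cls [y]) (cls [z])" "le_L A (cls [z]) (cls w)"
      using cls_letter_le[OF xy(3) z(3)] cls_letter_le[OF xy(4) z(4)] letter_divides_iff[OF z(2) w]
      by simp_all
    moreover have "cls [z] \<in> ?Q" using z(1) by (intro imageI) simp
    ultimately show ?thesis by (intro bexI[of _ "cls [z]"] conjI)
  qed
  have move: "\<exists>y' \<in> ?P. y' \<in> carrier (G i) \<and> cls [y'] = cls [y]"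
    if "y \<in> ?P" "y \<in> carrier (G j)" "w \<in> amalg_words M1 M2" "le_L A (cls [y]) (cls w)"
      "fst (fam.peel j (fam.nf w)) \<in> e j ` carrier N" for y w i j
  proof -
    have "le_L (G j) y (fst (fam.peel j (fam.nf w)))" using letter_divides_iff[OF that(2,3)] that(4) by simp
    then obtain r where "r \<in> carrier (G j)" "fst (fam.peel j (fam.nf w)) = y \<otimes>\<^bsub>G j\<^esub> r"
      unfolding le_L_def by blast
    then have "y \<in> e j ` carrier N" using summand_factor[OF that(2)] that(5) by simp
    then obtain n where n: "n \<in> carrier N" "y = e j n" by blast
    then show ?thesis
      using that(1) inP(4)[OF n(1)] cls_letter_e[OF n(1), of i j] fam.e_closed[OF n(1), of i]
      by (intro bexI[of _ "e i n"]) simp_all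
  qed
  have base: "\<exists>z \<in> ?Q. le_L A (cls [x]) z \<and> le_L A (cls [y]) z \<and> le_L A z (cls w)"
    if xy: "x \<in> ?P" "y \<in> ?P" and w: "w \<in> amalg_words M1 M2"
      and div: "le_L A (cls [x]) (cls w)" "le_L A (cls [y]) (cls w)" for x y w
  proof -
    obtain i j where ij: "x \<in> carrier (G i)" "y \<in> carrier (G j)"
      using xy inP(1) by (blast elim: fam.lettersE)
    consider "i = j" | "fst (fam.peel i (fam.nf w)) \<in> e i ` carrier N"
      | "fst (fam.peel j (fam.nf w)) \<in> e j ` carrier N"
      using fam.peel_in_base[OF nf_states[OF w]] by blast
    then show ?thesis
    proof cases
      case 1
      then show ?thesis using same_side xy ij w div by blast
    next
      case 2
      then obtain x' where "x' \<in> ?P" "x' \<in> carrier (G j)" "cls [x'] = cls [x]"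
        using move[OF xy(1) ij(1) w div(1)] by blast
      then show ?thesis using same_side[of x' y j w] xy ij w div by simp
    next
      case 3
      then obtain y' where "y' \<in> ?P" "y' \<in> carrier (G i)" "cls [y'] = cls [y]"
        using move[OF xy(2) ij(2) w div(2)] by blast
      then show ?thesis using same_side[of x y' i w] xy ij w div by simp
    qed
  qed
  have gen: "\<exists>x \<in> (\<lambda>x. cls [x]) ` ?P - {\<one>\<^bsub>A\<^esub>}. le_L A x (cls w)"
    if "w \<in> lists ?P" "cls w \<noteq> \<one>\<^bsub>A\<^esub>" for w
    using that
  proof (induction w)
    case Nil
    then show ?case by (simp add: one_A)
  next
    case (Cons x w)
    then have x: "x \<in> ?P" "x \<in> fam.letters" and w: "w \<in> lists ?P" "w \<in> amalg_words M1 M2"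
      using inP(1,2) by auto
    note eq = cls_Cons[OF x(2) w(2)]
    show ?case
    proof (cases "cls [x] = \<one>\<^bsub>A\<^esub>")
      case True
      then have "cls (x # w) = cls w" using eq cls_in_carrier[OF w(2)] by simp
      then show ?thesis using Cons w by simp
    next
      case False
      moreover have "le_L A (cls [x]) (cls (x # w))"
        using le_LI[OF cls_in_carrier[OF w(2)], of "cls [x]"] eq by simp
      ultimately show ?thesis using x(1) by blast
    qed
  qed
  have "\<exists>c \<in> ?Q. le_L A a c \<and> le_L A b c \<and> le_L A c d"
  proof (rule directed_divisors[where X = "(\<lambda>x. cls [x]) ` ?P", OF monoid_A A_l_cancel wf_right_divisors])
    show "?Q \<subseteq> carrier A" by (rule Q_carrier[OF par trace])
    show "x \<otimes>\<^bsub>A\<^esub> y \<in> ?Q \<longleftrightarrow> x \<in> ?Q \<and> y \<in> ?Q" if "x \<in> carrier A" "y \<in> carrier A" for x y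
      by (rule Q_mult[OF par trace that])
    show "\<exists>x \<in> (\<lambda>x. cls [x]) ` ?P - {\<one>\<^bsub>A\<^esub>}. le_L A x q" if "q \<in> ?Q" "q \<noteq> \<one>\<^bsub>A\<^esub>" for q
      using that gen by blast
    show "(\<lambda>x. cls [x]) ` ?P \<subseteq> carrier A" using inP(1) by (auto intro!: cls_in_carrier simp: words_eq)
    show "\<exists>z \<in> ?Q. le_L A x z \<and> le_L A y z \<and> le_L A z q"
      if "x \<in> (\<lambda>x. cls [x]) ` ?P" "y \<in> (\<lambda>x. cls [x]) ` ?P" "q \<in> carrier A" "le_L A x q" "le_L A y q" for x y q
      using that base unfolding carrier_A by blast
  qed (use d ab in simp_all)
  then show ?thesis by blast
qed

section \<open>Right divisors by reversal\<close>

lemma op_amalgam: "preGarside_amalgam (op_monoid M1) (op_monoid M2) (op_monoid N) \<iota>1 \<iota>2"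
  using preGarside1 preGarside2 monoid_N emb1 emb2
  by (intro preGarside_amalgam.intro preGarside_op_monoid monoid_op_monoid parabolic_embedding_op_monoid)

interpretation op: preGarside_amalgam "op_monoid M1" "op_monoid M2" "op_monoid N" \<iota>1 \<iota>2
  by (rule op_amalgam)

lemma op_words: "amalg_words (op_monoid M1) (op_monoid M2) = amalg_words M1 M2"
  by (simp add: amalg_words_def)

lemma rev_words: "rev w \<in> amalg_words M1 M2 \<longleftrightarrow> w \<in> amalg_words M1 M2"
  by (simp add: amalg_words_def rev_in_lists)

text \<open>Reversal of words turns the amalgam of the opposite monoids into the opposite of the amalgam, so every
result about left divisors has a mirror image.\<close>

lemma op_eqv_iff: "op.eqv u v \<longleftrightarrow> eqv (rev u) (rev v)"
  using amalg_eq_rev[of M1 M2 N \<iota>1 \<iota>2 "rev u" "rev v"]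
    amalg_eq_rev[of "op_monoid M1" "op_monoid M2" "op_monoid N" \<iota>1 \<iota>2 u v] by auto

lemma op_le_iff:
  assumes "u \<in> amalg_words M1 M2" "d \<in> amalg_words M1 M2"
  shows "le_L op.A (op.cls u) (op.cls d) \<longleftrightarrow> le_R A (cls (rev u)) (cls (rev d))"
proof -
  have "le_L op.A (op.cls u) (op.cls d) \<longleftrightarrow> (\<exists>v \<in> amalg_words M1 M2. op.cls d = op.cls (u @ v))"
    using assms by (auto simp: le_L_def op.carrier_A op_words op.mult_cls)
  also have "\<dots> \<longleftrightarrow> (\<exists>v \<in> amalg_words M1 M2. op.eqv d (u @ v))"
    using op.cls_eqD op.cls_eqI assms op_words by (metis amalg_words_simps(4))
  also have "\<dots> \<longleftrightarrow> (\<exists>v \<in> amalg_words M1 M2. eqv (rev d) (v @ rev u))"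
    unfolding op_eqv_iff rev_append by (metis rev_words rev_rev_ident)
  also have "\<dots> \<longleftrightarrow> (\<exists>v \<in> amalg_words M1 M2. cls (rev d) = cls (v @ rev u))"
    using cls_eqD cls_eqI assms rev_words by (metis amalg_words_simps(4))
  also have "\<dots> \<longleftrightarrow> le_R A (cls (rev u)) (cls (rev d))"
    using assms rev_words by (auto simp: le_R_def carrier_A mult_cls)
  finally show ?thesis .
qed

lemma common_multiple_R:
  assumes par: "parabolic M1' M1" "parabolic M2' M2"
    and trace: "{n \<in> carrier N. \<iota>1 n \<in> M1'} = N'" "{n \<in> carrier N. \<iota>2 n \<in> M2'} = N'"
    and d: "d \<in> carrier A" and ab: "a \<in> cls ` lists (M1' <+> M2')" "b \<in> cls ` lists (M1' <+> M2')"
      "le_R A a d" "le_R A b d"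
  shows "\<exists>c \<in> cls ` lists (M1' <+> M2'). le_R A a c \<and> le_R A b c"
proof -
  let ?P = "M1' <+> M2'"
  obtain u v w where uvw: "u \<in> lists ?P" "v \<in> lists ?P" "w \<in> amalg_words M1 M2" "a = cls u" "b = cls v" "d = cls w"
    using ab d by (auto simp: carrier_A)
  then have words: "u \<in> amalg_words M1 M2" "v \<in> amalg_words M1 M2" using lists_P[OF par trace] by blast+
  have "le_L op.A (op.cls (rev u)) (op.cls (rev w))" "le_L op.A (op.cls (rev v)) (op.cls (rev w))"
    using op_le_iff[of "rev u" "rev w"] op_le_iff[of "rev v" "rev w"] uvw words ab(3,4)
    by (simp_all add: rev_words)
  moreover have "op.cls (rev w) \<in> carrier op.A"
    using uvw(3) by (auto simp: op.carrier_A op_words rev_words)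
  moreover have "op.cls (rev u) \<in> op.cls ` lists ?P" "op.cls (rev v) \<in> op.cls ` lists ?P"
    using uvw(1,2) by (simp_all add: rev_in_lists)
  ultimately obtain c where c: "c \<in> lists ?P"
    "le_L op.A (op.cls (rev u)) (op.cls c)" "le_L op.A (op.cls (rev v)) (op.cls c)"
    using op.common_multiple_L[OF parabolic_op_monoid[OF par(1)] parabolic_op_monoid[OF par(2)],
        of N' "op.cls (rev w)" "op.cls (rev u)" "op.cls (rev v)"] trace by auto
  then have "le_R A (cls u) (cls (rev c))" "le_R A (cls v) (cls (rev c))"
    using op_le_iff[of "rev u" c] op_le_iff[of "rev v" c] words lists_P[OF par trace c(1)]
    by (simp_all add: rev_words)
  moreover have "cls (rev c) \<in> cls ` lists ?P" using c(1) by (simp add: rev_in_lists)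
  ultimately show ?thesis using uvw by blast
qed

lemma inl_retract_R:
  assumes "d \<in> carrier A"
  shows "\<exists>p \<in> carrier M1. \<forall>x \<in> carrier M1. le_R A (inl x) d \<longleftrightarrow> le_R M1 x p"
proof -
  obtain w where w: "w \<in> amalg_words M1 M2" "d = cls w" using assms by (auto simp: carrier_A)
  then have "op.cls (rev w) \<in> carrier op.A" by (auto simp: op.carrier_A op_words rev_words)
  moreover have "le_L op.A (op.inl x) (op.cls (rev w)) \<longleftrightarrow> le_R A (inl x) d" if "x \<in> carrier M1" for x
    using op_le_iff[of "[Inl x]" "rev w"] that w by (simp add: amalg_inl_def rev_words)
  ultimately show ?thesis using op.inl_retract_L[of "op.cls (rev w)"] by simp
qed

lemma inr_retract_R:
  assumes "d \<in> carrier A"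
  shows "\<exists>p \<in> carrier M2. \<forall>x \<in> carrier M2. le_R A (inr x) d \<longleftrightarrow> le_R M2 x p"
proof -
  obtain w where w: "w \<in> amalg_words M1 M2" "d = cls w" using assms by (auto simp: carrier_A)
  then have "op.cls (rev w) \<in> carrier op.A" by (auto simp: op.carrier_A op_words rev_words)
  moreover have "le_L op.A (op.inr x) (op.cls (rev w)) \<longleftrightarrow> le_R A (inr x) d" if "x \<in> carrier M2" for x
    using op_le_iff[of "[Inr x]" "rev w"] that w by (simp add: amalg_inr_def rev_words)
  ultimately show ?thesis using op.inr_retract_L[of "op.cls (rev w)"] by simp
qed


section \<open>Parabolic submonoids of the amalgam\<close>

text \<open>A join divides every common multiple, and by closure under factors it suffices that one of these lies
in the submonoid.\<close>

lemma parabolic_generated: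
  assumes par: "parabolic M1' M1" "parabolic M2' M2"
    and trace: "{n \<in> carrier N. \<iota>1 n \<in> M1'} = N'" "{n \<in> carrier N. \<iota>2 n \<in> M2'} = N'"
  shows "parabolic (cls ` lists (M1' <+> M2')) A"
proof -
  let ?Q = "cls ` lists (M1' <+> M2')"
  note Q_mult' = Q_mult[OF par trace]
  have join_L: "c \<in> ?Q" if ab: "a \<in> ?Q" "b \<in> ?Q" and c: "is_join (le_L A) (carrier A) a b c" for a b c
  proof -
    have "c \<in> carrier A" "le_L A a c" "le_L A b c" using c by (simp_all add: is_join_def)
    then obtain q where q: "q \<in> ?Q" "le_L A a q" "le_L A b q"
      using common_multiple_L[OF par trace _ ab] by blast
    moreover have "q \<in> carrier A" using q Q_carrier[OF par trace] by blast
    ultimately have "le_L A c q" using c by (simp add: is_join_def)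
    then obtain k where "k \<in> carrier A" "q = c \<otimes>\<^bsub>A\<^esub> k" by (auto simp: le_L_def)
    then show ?thesis using Q_mult'[of c k] \<open>c \<in> carrier A\<close> q(1) by simp
  qed
  have join_R: "c \<in> ?Q" if ab: "a \<in> ?Q" "b \<in> ?Q" and c: "is_join (le_R A) (carrier A) a b c" for a b c
  proof -
    have "c \<in> carrier A" "le_R A a c" "le_R A b c" using c by (simp_all add: is_join_def)
    then obtain q where q: "q \<in> ?Q" "le_R A a q" "le_R A b q"
      using common_multiple_R[OF par trace _ ab] by blast
    moreover have "q \<in> carrier A" using q Q_carrier[OF par trace] by blast
    ultimately have "le_R A c q" using c by (simp add: is_join_def)
    then obtain k where "k \<in> carrier A" "q = k \<otimes>\<^bsub>A\<^esub> c" by (auto simp: le_R_def)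
    then show ?thesis using Q_mult'[of k c] \<open>c \<in> carrier A\<close> q(1) by simp
  qed
  show ?thesis
    unfolding parabolic_def
  proof (intro conjI[OF Q_submonoid[OF par trace]] conjI ballI allI impI)
    fix a b assume "a \<in> carrier A" "b \<in> carrier A" "a \<otimes>\<^bsub>A\<^esub> b \<in> ?Q"
    then show "a \<in> ?Q" "b \<in> ?Q" using Q_mult'[of a b] by blast+
  qed (rule join_L join_R; assumption)+
qed

theorem parabolic_embedding_canon:
  assumes par: "parabolic M1' M1" "parabolic M2' M2"
    and trace: "{n \<in> carrier N. \<iota>1 n \<in> M1'} = N'" "{n \<in> carrier N. \<iota>2 n \<in> M2'} = N'"
  shows "parabolic_embedding (amalg_canon M1 M2 N \<iota>1 \<iota>2)
    (amalg (restrict_monoid M1 M1') (restrict_monoid M2 M2') (restrict_monoid N N') \<iota>1 \<iota>2) A"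
  using canon_hom[OF par trace] canon_inj[OF par trace] canon_image[OF par trace]
    parabolic_generated[OF par trace]
  by (simp add: parabolic_embedding_def)

lemma cls_generated_by:
  assumes B: "submonoid B A" and X: "X \<subseteq> fam.letters" "\<And>x. x \<in> X \<Longrightarrow> cls [x] \<in> B"
    and w: "w \<in> lists X"
  shows "cls w \<in> B"
  using w
proof (induction w)
  case Nil
  then show ?case using submonoid.one_closed[OF B] by (simp add: one_A)
next
  case (Cons x w)
  then have "x \<in> fam.letters" "w \<in> amalg_words M1 M2" using X(1) by (auto simp: words_eq)
  then show ?case
    using cls_Cons[of x w] submonoid.m_closed[OF B X(2)[OF Cons.hyps(1)] Cons.IH] by simp
qed

lemma submonoid_hom_image:
  assumes "monoid K" "h \<in> monoid_hom K A"
  shows "submonoid (h ` carrier K) A"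
proof -
  interpret K: monoid K by (rule assms(1))
  have h: "h x \<in> carrier A" "h (x \<otimes>\<^bsub>K\<^esub> y) = h x \<otimes>\<^bsub>A\<^esub> h y" "h \<one>\<^bsub>K\<^esub> = \<one>\<^bsub>A\<^esub>"
    if "x \<in> carrier K" "y \<in> carrier K" for x y
    using assms(2) that by (auto simp: monoid_hom_def hom_def)
  show ?thesis
  proof (rule submonoid.intro)
    show "h ` carrier K \<subseteq> carrier A" using h(1) by blast
    show "\<one>\<^bsub>A\<^esub> \<in> h ` carrier K" using h(3) K.one_closed by (metis imageI)
    fix a b assume "a \<in> h ` carrier K" "b \<in> h ` carrier K"
    then obtain x y where "x \<in> carrier K" "y \<in> carrier K" "a = h x" "b = h y" by blast
    then show "a \<otimes>\<^bsub>A\<^esub> b \<in> h ` carrier K" using h(2)[of x y] K.m_closed by (metis imageI)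
  qed
qed

lemma letter_inj:
  assumes "x \<in> carrier (G i)" "y \<in> carrier (G i)" "cls [x] = cls [y]"
  shows "x = y"
proof -
  have "[x] \<in> amalg_words M1 M2" "[y] \<in> amalg_words M1 M2"
    using fam.letters_closed[OF assms(1)] fam.letters_closed[OF assms(2)] by (simp_all add: words_eq)
  then have nf: "fam.nf [x] = fam.nf [y]" using cls_eq_iff assms(3) by simp
  have p: "fam.peel i (\<one>\<^bsub>N\<^esub>, []) = (\<one>\<^bsub>G i\<^esub>, [])" by (simp add: fam.peel.simps)
  have "fam.peel i (fam.nf [z]) = (z, [])" if "z \<in> carrier (G i)" for z
    using fam.peel_act(1)[OF that fam.initial_state p] that by (simp add: fam.nf_def)
  then show ?thesis using nf assms by (metis prod.inject)
qed

text \<open>Recognizes \<open>M1\<close>, \<open>M2\<close> and \<open>N\<close> in the amalgam as submonoids generated by letters: they arise from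
\<open>(M1, N)\<close>, \<open>(N, M2)\<close> and \<open>(N, N)\<close>.\<close>

lemma parabolic_embedding_generated:
  assumes K: "monoid K" and h: "h \<in> monoid_hom K A" "inj_on h (carrier K)"
    and par: "parabolic M1' M1" "parabolic M2' M2"
    and trace: "{n \<in> carrier N. \<iota>1 n \<in> M1'} = N'" "{n \<in> carrier N. \<iota>2 n \<in> M2'} = N'"
    and in_h: "inl ` M1' \<subseteq> h ` carrier K" "inr ` M2' \<subseteq> h ` carrier K"
    and of_h: "h ` carrier K \<subseteq> inl ` M1' \<union> inr ` M2'"
  shows "parabolic_embedding h K A"
proof -
  have "h ` carrier K = cls ` lists (M1' <+> M2')"
  proof
    show "h ` carrier K \<subseteq> cls ` lists (M1' <+> M2')"
    proof
      fix q assume "q \<in> h ` carrier K"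
      then consider x where "x \<in> M1'" "q = inl x" | y where "y \<in> M2'" "q = inr y" using of_h by blast
      then show "q \<in> cls ` lists (M1' <+> M2')"
        by cases (auto simp: amalg_inl_def amalg_inr_def intro!: imageI)
    qed
    have "cls [z] \<in> h ` carrier K" if "z \<in> M1' <+> M2'" for z
      using that in_h by (auto simp: amalg_inl_def[symmetric] amalg_inr_def[symmetric])
    then show "cls ` lists (M1' <+> M2') \<subseteq> h ` carrier K"
      using cls_generated_by[OF submonoid_hom_image[OF K h(1)] P_letters[OF par trace]] by blast
  qed
  then show ?thesis using parabolic_generated[OF par trace] h by (simp add: parabolic_embedding_def)
qed

lemma iota_image: "{n \<in> carrier N. \<iota>1 n \<in> \<iota>1 ` carrier N} = carrier N"
  "{n \<in> carrier N. \<iota>2 n \<in> \<iota>2 ` carrier N} = carrier N"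
  "{n \<in> carrier N. \<iota>1 n \<in> carrier M1} = carrier N" "{n \<in> carrier N. \<iota>2 n \<in> carrier M2} = carrier N"
  using \<iota>1 \<iota>2 by auto

lemma inl_inj: "inj_on inl (carrier M1)"
  using letter_inj[of "Inl _" True "Inl _"] by (auto simp: inj_on_def amalg_inl_def)

lemma inr_inj: "inj_on inr (carrier M2)"
  using letter_inj[of "Inr _" False "Inr _"] by (auto simp: inj_on_def amalg_inr_def)

theorem parabolic_embedding_inl: "parabolic_embedding inl M1 A"
  by (rule parabolic_embedding_generated[OF M1 inl_hom inl_inj parabolic_carrier[OF M1]
        parabolic_embeddingD(3)[OF emb2] iota_image(3,2)])
    (use inl_inr_glue \<iota>1 in \<open>auto simp: image_iff Pi_iff\<close>)

theorem parabolic_embedding_inr: "parabolic_embedding inr M2 A"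
  by (rule parabolic_embedding_generated[OF M2 inr_hom inr_inj
        parabolic_embeddingD(3)[OF emb1] parabolic_carrier[OF M2] iota_image(1,4)])
    (use inl_inr_glue \<iota>2 in \<open>auto simp: image_iff Pi_iff\<close>)

lemma base_hom: "(\<lambda>n. inl (\<iota>1 n)) \<in> monoid_hom N A"
  using inl_hom parabolic_embeddingD(1)[OF emb1] by (auto simp: monoid_hom_def hom_def Pi_iff)

theorem parabolic_embedding_base: "parabolic_embedding (\<lambda>n. inl (\<iota>1 n)) N A"
proof (rule parabolic_embedding_generated[OF monoid_N base_hom _
        parabolic_embeddingD(3)[OF emb1] parabolic_embeddingD(3)[OF emb2] iota_image(1,2)])
  show "inj_on (\<lambda>n. inl (\<iota>1 n)) (carrier N)"
    using comp_inj_on[OF parabolic_embeddingD(2)[OF emb1] inj_on_subset[OF inl_inj]] \<iota>1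
    by (auto simp: comp_def)
qed (use inl_inr_glue in auto)

theorem parabolic_decomposition:
  assumes M': "parabolic M' A"
  defines "M1' \<equiv> {x \<in> carrier M1. inl x \<in> M'}" and "M2' \<equiv> {y \<in> carrier M2. inr y \<in> M'}"
    and "N' \<equiv> {n \<in> carrier N. inl (\<iota>1 n) \<in> M'}"
  shows "parabolic M1' M1" "parabolic M2' M2" "parabolic N' N"
    and "{n \<in> carrier N. \<iota>1 n \<in> M1'} = N'" "{n \<in> carrier N. \<iota>2 n \<in> M2'} = N'"
    and "amalg_canon M1 M2 N \<iota>1 \<iota>2 \<in>
      iso (amalg (restrict_monoid M1 M1') (restrict_monoid M2 M2') (restrict_monoid N N') \<iota>1 \<iota>2)
        (restrict_monoid A M')"
proof -
  show par1: "parabolic M1' M1"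
    unfolding M1'_def by (rule parabolic_vimage[OF M1 inl_hom M' inl_retract_L inl_retract_R])
  show par2: "parabolic M2' M2"
    unfolding M2'_def by (rule parabolic_vimage[OF M2 inr_hom M' inr_retract_L inr_retract_R])
  show trace1: "{n \<in> carrier N. \<iota>1 n \<in> M1'} = N'" and trace2: "{n \<in> carrier N. \<iota>2 n \<in> M2'} = N'"
    using \<iota>1 \<iota>2 inl_inr_glue by (auto simp: M1'_def M2'_def N'_def)
  have "parabolic {n \<in> carrier N. \<iota>1 n \<in> M1'} N"
    by (rule parabolic_vimage[OF monoid_N parabolic_embeddingD(1)[OF emb1] par1
          parabolic_embedding_retract_L[OF preGarside1 monoid_N emb1]
          parabolic_embedding_retract_R[OF preGarside1 monoid_N emb1]])
  then show "parabolic N' N" by (simp only: trace1)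
  have words: "cls w \<in> M' \<longleftrightarrow> w \<in> lists (M1' <+> M2')" if "w \<in> amalg_words M1 M2" for w
    using that
  proof (induction w)
    case Nil
    then show ?case using parabolicD(3)[OF M'] by (simp add: one_A)
  next
    case (Cons x w)
    have x: "x \<in> fam.letters" and w: "w \<in> amalg_words M1 M2"
      using Cons.prems by (simp_all add: words_eq)
    have "x \<in> carrier M1 <+> carrier M2"
      using Cons.prems by (simp add: amalg_words_def)
    then have "cls [x] \<in> M' \<longleftrightarrow> x \<in> M1' <+> M2'"
      by (auto simp: M1'_def M2'_def amalg_inl_def amalg_inr_def)
    moreover have "cls [x] \<in> carrier A" using cls_in_carrier[of "[x]"] x by (simp add: words_eq)
    ultimately show ?case
      using parabolic_mult_iff[OF M' _ cls_in_carrier[OF w], of "cls [x]"] cls_Cons[OF x w] Cons.IH w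
      by simp
  qed
  have "M' = cls ` lists (M1' <+> M2')"
  proof (intro equalityI subsetI)
    fix q assume "q \<in> M'"
    moreover from this obtain w where "w \<in> amalg_words M1 M2" "q = cls w"
      using parabolicD(2)[OF M'] by (auto simp: carrier_A)
    ultimately show "q \<in> cls ` lists (M1' <+> M2')" using words by simp
  next
    fix q assume "q \<in> cls ` lists (M1' <+> M2')"
    then show "q \<in> M'" using words lists_P[OF par1 par2 trace1 trace2] by blast
  qed
  then show "amalg_canon M1 M2 N \<iota>1 \<iota>2 \<in>
      iso (amalg (restrict_monoid M1 M1') (restrict_monoid M2 M2') (restrict_monoid N N') \<iota>1 \<iota>2)
        (restrict_monoid A M')"
    using canon_iso[OF par1 par2 trace1 trace2] by simp
qed

end


theorem proposition3p12:
  fixes M1 :: "'a monoid" and M2 :: "'b monoid" and N :: "'c monoid"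
    and \<iota>1 :: "'c \<Rightarrow> 'a" and \<iota>2 :: "'c \<Rightarrow> 'b"
    and M :: "('a + 'b) list set monoid"
  assumes "preGarside M1" and "preGarside M2" and "monoid N"
    and "parabolic_embedding \<iota>1 N M1" and "parabolic_embedding \<iota>2 N M2"
    and "M = amalg M1 M2 N \<iota>1 \<iota>2"
  shows
    "(\<forall>M1' M2' N'.
        parabolic M1' M1 \<and> parabolic M2' M2 \<and>
        {n \<in> carrier N. \<iota>1 n \<in> M1'} = N' \<and> {n \<in> carrier N. \<iota>2 n \<in> M2'} = N' \<longrightarrow>
        parabolic_embedding (amalg_canon M1 M2 N \<iota>1 \<iota>2)
          (amalg (restrict_monoid M1 M1') (restrict_monoid M2 M2') (restrict_monoid N N') \<iota>1 \<iota>2) M) \<and>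
     parabolic_embedding (amalg_inl M1 M2 N \<iota>1 \<iota>2) M1 M \<and>
     parabolic_embedding (amalg_inr M1 M2 N \<iota>1 \<iota>2) M2 M \<and>
     parabolic_embedding (\<lambda>n. amalg_inl M1 M2 N \<iota>1 \<iota>2 (\<iota>1 n)) N M \<and>
     (\<forall>M'. parabolic M' M \<longrightarrow>
        (\<exists>M1' M2' N'.
           parabolic M1' M1 \<and> parabolic M2' M2 \<and> parabolic N' N \<and>
           {n \<in> carrier N. \<iota>1 n \<in> M1'} = N' \<and> {n \<in> carrier N. \<iota>2 n \<in> M2'} = N' \<and>
           amalg_canon M1 M2 N \<iota>1 \<iota>2 \<in>
             iso (amalg (restrict_monoid M1 M1') (restrict_monoid M2 M2') (restrict_monoid N N') \<iota>1 \<iota>2)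
                 (restrict_monoid M M')))"
proof -
  interpret preGarside_amalgam M1 M2 N \<iota>1 \<iota>2
    using assms(1-5) by (rule preGarside_amalgam.intro)
  show ?thesis
    unfolding assms(6)
  proof (intro conjI allI impI)
    fix M' assume M': "parabolic M' A"
    show "\<exists>M1' M2' N'.
       parabolic M1' M1 \<and> parabolic M2' M2 \<and> parabolic N' N \<and>
       {n \<in> carrier N. \<iota>1 n \<in> M1'} = N' \<and> {n \<in> carrier N. \<iota>2 n \<in> M2'} = N' \<and>
       amalg_canon M1 M2 N \<iota>1 \<iota>2 \<in>
         iso (amalg (restrict_monoid M1 M1') (restrict_monoid M2 M2') (restrict_monoid N N') \<iota>1 \<iota>2)
             (restrict_monoid A M')"
      by (intro exI conjI) (rule parabolic_decomposition[OF M'])+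
  next
    fix M1' M2' N'
    assume "parabolic M1' M1 \<and> parabolic M2' M2 \<and>
      {n \<in> carrier N. \<iota>1 n \<in> M1'} = N' \<and> {n \<in> carrier N. \<iota>2 n \<in> M2'} = N'"
    then show "parabolic_embedding (amalg_canon M1 M2 N \<iota>1 \<iota>2)
        (amalg (restrict_monoid M1 M1') (restrict_monoid M2 M2') (restrict_monoid N N') \<iota>1 \<iota>2) A"
      by (elim conjE) (rule parabolic_embedding_canon)
  qed (rule parabolic_embedding_inl parabolic_embedding_inr parabolic_embedding_base)+
qed

end
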